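(* Let $G$ be a group, $\mathcal H$ a complex separable Hilbert space and $V\colon G\to\mathcal U(\mathcal H)$ a unitary representation which decomposes as $V=\bigoplus_{n=1}^N V_n$ on $\mathcal H=\bigoplus_{n=1}^N\mathcal H_n$, $N\in\mathbb N\cup\{\infty\}$, where the subrepresentations $V_n$ on $\mathcal H_n$ are irreducible and mutually inequivalent. Let $\mathcal V=\{V(g)\mid g\in G\}''$. Let $T\colon\mathcal D(T)\subset\mathcal H\to\mathcal H$ be a densely defined self-adjoint $G$-invariant operator. Then: (i) each orthogonal projection $P_k$ onto $\mathcal H_k$ is central in $\mathcal V$ (i.e. $P_k\in\mathcal V\cap\mathcal V'$) and reduces $T$ (i.e. $P_k\in\{T\}'$); (ii) if $N<\infty$, then $T$ is bounded and there exist $\lambda_1,\dots,\lambda_N\in\mathbb T\setminus\{-1\}$ such that $T=\bigoplus_{k=1}^N i\frac{\lambda_k-1}{\lambda_k+1}\mathbb I_{\mathcal H_k}$ with respect to the decomposition $\mathcal H=\bigoplus_k\mathcal H_k$.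
   Context: $T$ is $G$-invariant if $V(g)\mathcal D(T)\subset\mathcal D(T)$ and $TV(g)\Psi=V(g)T\Psi$ for all $g\in G$, $\Psi\in\mathcal D(T)$. For $\mathcal S\subset\mathcal L(\mathcal H)$, $\mathcal S'$ is its commutant. For a densely defined operator $T$, $\{T\}'=\{A\in\mathcal L(\mathcal H)\mid A\mathcal D(T)\subset\mathcal D(T),\ TA\Phi=AT\Phi\ \forall\Phi\in\mathcal D(T)\}$. $\mathbb T$ is the unit circle in $\mathbb C$. *)

theory Defs
  imports "HOL-Analysis.Analysis" "HOL-Algebra.Group" "HOL-Library.Extended_Nat"
begin

text \<open>HOL-Analysis only provides real inner product spaces, so complex inner product
spaces are introduced as a type class: a real normed vector space equipped with a
complex scalar multiplication (compatible with the real one) and a sesquilinear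
inner product (antilinear in the first, linear in the second argument) inducing the norm.\<close>

class complex_inner = real_normed_vector +
  fixes cscale :: "complex \<Rightarrow> 'a \<Rightarrow> 'a"
    and cinner :: "'a \<Rightarrow> 'a \<Rightarrow> complex"
  assumes cscale_add_right: "cscale a (x + y) = cscale a x + cscale a y"
    and cscale_add_left: "cscale (a + b) x = cscale a x + cscale b x"
    and cscale_cscale: "cscale a (cscale b x) = cscale (a * b) x"
    and cscale_one: "cscale 1 x = x"
    and scaleR_cscale: "scaleR r x = cscale (complex_of_real r) x"
    and cinner_commute: "cinner x y = cnj (cinner y x)"
    and cinner_add_left: "cinner (x + y) z = cinner x z + cinner y z"
    and cinner_cscale_left: "cinner (cscale a x) y = cnj a * cinner x y"
    and cinner_self_nonneg: "0 \<le> Re (cinner x x)"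
    and cinner_self_eq_zero: "cinner x x = 0 \<longleftrightarrow> x = 0"
    and norm_eq_sqrt_cinner: "norm x = sqrt (Re (cinner x x))"

class chilbert_space = complex_inner + complete_space

definition csubspace :: "'a::complex_inner set \<Rightarrow> bool" where
  "csubspace S \<longleftrightarrow> 0 \<in> S \<and> (\<forall>x\<in>S. \<forall>y\<in>S. x + y \<in> S) \<and> (\<forall>c. \<forall>x\<in>S. cscale c x \<in> S)"

definition closed_csubspace :: "'a::complex_inner set \<Rightarrow> bool" where
  "closed_csubspace S \<longleftrightarrow> csubspace S \<and> closed S"

definition cspan :: "'a::complex_inner set \<Rightarrow> 'a set" where
  "cspan S = \<Inter>{M. csubspace M \<and> S \<subseteq> M}"

definition bounded_clin :: "('a::complex_inner \<Rightarrow> 'a) \<Rightarrow> bool" where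
  "bounded_clin A \<longleftrightarrow> (\<forall>x y. A (x + y) = A x + A y) \<and> (\<forall>c x. A (cscale c x) = cscale c (A x))
     \<and> (\<exists>K. \<forall>x. norm (A x) \<le> K * norm x)"

definition unitary_op :: "('a::complex_inner \<Rightarrow> 'a) \<Rightarrow> bool" where
  "unitary_op U \<longleftrightarrow> bounded_clin U \<and> surj U \<and> (\<forall>x y. cinner (U x) (U y) = cinner x y)"

definition commutant :: "('a::complex_inner \<Rightarrow> 'a) set \<Rightarrow> ('a \<Rightarrow> 'a) set" where
  "commutant S = {A. bounded_clin A \<and> (\<forall>B\<in>S. A \<circ> B = B \<circ> A)}"

definition orth_proj :: "'a::complex_inner set \<Rightarrow> 'a \<Rightarrow> 'a" where
  "orth_proj M x = (THE y. y \<in> M \<and> (\<forall>z\<in>M. cinner (x - y) z = 0))"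

text \<open>A (possibly unbounded) operator T with domain D(T) is represented by the pair
(D, T); the values of T outside D are irrelevant.\<close>

definition linear_op_on :: "'a::complex_inner set \<Rightarrow> ('a \<Rightarrow> 'a) \<Rightarrow> bool" where
  "linear_op_on D T \<longleftrightarrow> csubspace D \<and> (\<forall>x\<in>D. \<forall>y\<in>D. T (x + y) = T x + T y)
     \<and> (\<forall>c. \<forall>x\<in>D. T (cscale c x) = cscale c (T x))"

definition densely_defined :: "'a::complex_inner set \<Rightarrow> ('a \<Rightarrow> 'a) \<Rightarrow> bool" where
  "densely_defined D T \<longleftrightarrow> linear_op_on D T \<and> closure D = UNIV"

definition adjoint_dom :: "'a::complex_inner set \<Rightarrow> ('a \<Rightarrow> 'a) \<Rightarrow> 'a set" where
  "adjoint_dom D T = {y. \<exists>z. \<forall>x\<in>D. cinner (T x) y = cinner x z}"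

text \<open>T = T*: same domain, and T* y = T y for y in the domain (T* y is the unique z
with cinner (T x) y = cinner x z for all x in D, by density).\<close>
definition self_adjoint :: "'a::complex_inner set \<Rightarrow> ('a \<Rightarrow> 'a) \<Rightarrow> bool" where
  "self_adjoint D T \<longleftrightarrow> densely_defined D T \<and> adjoint_dom D T = D
     \<and> (\<forall>y\<in>D. \<forall>x\<in>D. cinner (T x) y = cinner x (T y))"

definition op_commutant :: "'a::complex_inner set \<Rightarrow> ('a \<Rightarrow> 'a) \<Rightarrow> ('a \<Rightarrow> 'a) set" where
  "op_commutant D T = {A. bounded_clin A \<and> A ` D \<subseteq> D \<and> (\<forall>x\<in>D. T (A x) = A (T x))}"

definition unitary_rep :: "('g, 'b) monoid_scheme \<Rightarrow> ('g \<Rightarrow> 'a::complex_inner \<Rightarrow> 'a) \<Rightarrow> bool" where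
  "unitary_rep G V \<longleftrightarrow> group G \<and> (\<forall>g\<in>carrier G. unitary_op (V g))
     \<and> (\<forall>g\<in>carrier G. \<forall>h\<in>carrier G. V (g \<otimes>\<^bsub>G\<^esub> h) = V g \<circ> V h)
     \<and> V \<one>\<^bsub>G\<^esub> = id"

definition G_invariant_op ::
  "('g, 'b) monoid_scheme \<Rightarrow> ('g \<Rightarrow> 'a::complex_inner \<Rightarrow> 'a) \<Rightarrow> 'a set \<Rightarrow> ('a \<Rightarrow> 'a) \<Rightarrow> bool" where
  "G_invariant_op G V D T \<longleftrightarrow> (\<forall>g\<in>carrier G. V g ` D \<subseteq> D \<and> (\<forall>x\<in>D. T (V g x) = V g (T x)))"

definition invariant_subspace ::
  "('g, 'b) monoid_scheme \<Rightarrow> ('g \<Rightarrow> 'a::complex_inner \<Rightarrow> 'a) \<Rightarrow> 'a set \<Rightarrow> bool" where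
  "invariant_subspace G V M \<longleftrightarrow> closed_csubspace M \<and> (\<forall>g\<in>carrier G. V g ` M \<subseteq> M)"

definition irreducible_subrep ::
  "('g, 'b) monoid_scheme \<Rightarrow> ('g \<Rightarrow> 'a::complex_inner \<Rightarrow> 'a) \<Rightarrow> 'a set \<Rightarrow> bool" where
  "irreducible_subrep G V M \<longleftrightarrow> invariant_subspace G V M \<and> M \<noteq> {0}
     \<and> (\<forall>L. invariant_subspace G V L \<and> L \<subseteq> M \<longrightarrow> L = {0} \<or> L = M)"

definition equivalent_subreps ::
  "('g, 'b) monoid_scheme \<Rightarrow> ('g \<Rightarrow> 'a::complex_inner \<Rightarrow> 'a) \<Rightarrow> 'a set \<Rightarrow> 'a set \<Rightarrow> bool" where
  "equivalent_subreps G V M1 M2 \<longleftrightarrow> (\<exists>U. U ` M1 = M2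
     \<and> (\<forall>x\<in>M1. \<forall>y\<in>M1. U (x + y) = U x + U y)
     \<and> (\<forall>c. \<forall>x\<in>M1. U (cscale c x) = cscale c (U x))
     \<and> (\<forall>x\<in>M1. \<forall>y\<in>M1. cinner (U x) (U y) = cinner x y)
     \<and> (\<forall>g\<in>carrier G. \<forall>x\<in>M1. U (V g x) = V g (U x)))"

definition orth_decomposition :: "nat set \<Rightarrow> (nat \<Rightarrow> 'a::complex_inner set) \<Rightarrow> bool" where
  "orth_decomposition I Hs \<longleftrightarrow> (\<forall>n\<in>I. closed_csubspace (Hs n))
     \<and> (\<forall>n\<in>I. \<forall>m\<in>I. n \<noteq> m \<longrightarrow> (\<forall>x\<in>Hs n. \<forall>y\<in>Hs m. cinner x y = 0))
     \<and> closure (cspan (\<Union>n\<in>I. Hs n)) = UNIV"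

end

theory Submission
  imports Defs
begin

text \<open>The resolvent \<open>R = (T + \<i>)\<^sup>-\<^sup>1\<close> is bounded and commutes with the representation. Since the
  components are irreducible and pairwise inequivalent, Schur's lemma shows that every bounded
  operator commuting with the representation maps each component to itself and hence commutes with
  its projection; for \<open>R\<close> this says that the projection reduces \<open>T\<close>. On each component \<open>R\<close>, and
  therefore \<open>T\<close>, is a scalar, which is real because \<open>T\<close> is symmetric.

  Schur's lemma in infinite dimension is obtained without the spectral theorem: for a symmetric
  contraction \<open>B\<close> the modulus \<open>S = \<bar>B\<bar>\<close> is constructed by iteration, and the kernel of \<open>S - B\<close>
  is invariant, so \<open>B\<close> is semidefinite on an irreducible component. Applied to \<open>A - c\<close> for all
  real \<open>c\<close>, this makes \<open>A\<close> a scalar.\<close>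

section \<open>Complex inner product spaces\<close>

text \<open>The obstacle is the domain: Schur's lemma concerns everywhere defined bounded operators,
  and a vector of a component is not known in advance to lie in \<open>D\<close>. The resolvent
  settles this because its range is \<open>D\<close>: once it is a nonzero scalar on a component,
  the whole component lies in \<open>D\<close>. Inequivalence enters by killing the off-diagonal
  blocks of a commuting operator. Invariance of a component alone gives only half of the commutation
  with its projection; the other half comes from the adjoint, which also commutes with the
  representation since the adjoint of \<open>V g\<close> is \<open>V\<close> at the inverse of
  \<open>g\<close>. The iteration for the modulus runs through polynomials of one operator, so
  commutation and invariant subspaces pass to the limit. Finiteness of \<open>N\<close> matters in
  (ii) since finite sums of vectors of \<open>D\<close> stay in \<open>D\<close>; with infinitely
  many components the real eigenvalues may be unbounded. The numbers on the circle are the Cayley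
  transforms of these eigenvalues, and -1 is the value missed by every real number.\<close>

lemma cinner_add_right:
  fixes x y z :: "'a::complex_inner"
  shows "cinner x (y + z) = cinner x y + cinner x z"
  by (metis cinner_add_left cinner_commute complex_cnj_add)

lemma cinner_cscale_right:
  fixes x y :: "'a::complex_inner"
  shows "cinner x (cscale a y) = a * cinner x y"
  by (metis cinner_commute cinner_cscale_left complex_cnj_cnj complex_cnj_mult)

lemma cscale_zero_left [simp]:
  fixes x :: "'a::complex_inner"
  shows "cscale 0 x = 0"
  by (metis cscale_add_left add_cancel_left_right add_0_right)

lemma cscale_zero_right [simp]:
  "cscale a 0 = (0::'a::complex_inner)"
  by (metis cscale_add_right add_cancel_left_right add_0_right)

lemma cscale_minus_left:
  fixes x :: "'a::complex_inner"
  shows "cscale (- a) x = - cscale a x"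
  by (metis cscale_add_left cscale_zero_left add.right_inverse minus_unique)

lemma cscale_minus_one:
  fixes x :: "'a::complex_inner"
  shows "cscale (- 1) x = - x"
  by (simp add: cscale_minus_left cscale_one)

lemma cscale_minus_right:
  fixes x :: "'a::complex_inner"
  shows "cscale a (- x) = - cscale a x"
  by (metis cscale_add_right cscale_zero_right add.right_inverse minus_unique)

lemma cscale_diff_right:
  fixes x y :: "'a::complex_inner"
  shows "cscale a (x - y) = cscale a x - cscale a y"
  by (metis cscale_add_right cscale_minus_right diff_conv_add_uminus)

lemma cscale_diff_left:
  fixes x :: "'a::complex_inner"
  shows "cscale (a - b) x = cscale a x - cscale b x"
  by (metis cscale_add_left cscale_minus_left diff_conv_add_uminus)

lemma cinner_minus_left:
  fixes x y :: "'a::complex_inner"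
  shows "cinner (- x) y = - cinner x y"
  using cinner_cscale_left[of "- 1" x y] by (simp add: cscale_minus_one)

lemma cinner_minus_right:
  fixes x y :: "'a::complex_inner"
  shows "cinner x (- y) = - cinner x y"
  using cinner_cscale_right[of x "- 1" y] by (simp add: cscale_minus_one)

lemma cinner_diff_left:
  fixes x y z :: "'a::complex_inner"
  shows "cinner (x - y) z = cinner x z - cinner y z"
  using cinner_add_left[of x "- y" z] by (simp add: cinner_minus_left)

lemma cinner_diff_right:
  fixes x y z :: "'a::complex_inner"
  shows "cinner x (y - z) = cinner x y - cinner x z"
  using cinner_add_right[of x y "- z"] by (simp add: cinner_minus_right)

lemma cinner_zero_left [simp]:
  fixes x :: "'a::complex_inner"
  shows "cinner 0 x = 0"
  using cinner_diff_left[of x x x] cinner_add_left[of 0 0 x] by simp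

lemma cinner_zero_right [simp]:
  fixes x :: "'a::complex_inner"
  shows "cinner x 0 = 0"
  using cinner_add_right[of x 0 0] by simp

lemma Re_cinner_self:
  fixes x :: "'a::complex_inner"
  shows "Re (cinner x x) = (norm x)\<^sup>2"
  by (simp add: norm_eq_sqrt_cinner cinner_self_nonneg)

lemma cinner_self:
  fixes x :: "'a::complex_inner"
  shows "cinner x x = complex_of_real ((norm x)\<^sup>2)"
proof -
  have "Im (cinner x x) = 0"
    using cinner_commute[of x x] by (metis Reals_cnj_iff complex_is_Real_iff)
  then show ?thesis
    by (simp add: complex_eq_iff Re_cinner_self)
qed

lemma Re_cinner_commute:
  fixes x y :: "'a::complex_inner"
  shows "Re (cinner x y) = Re (cinner y x)"
  by (metis cinner_commute cnj.sel(1))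

lemma norm_add_sq:
  fixes x y :: "'a::complex_inner"
  shows "(norm (x + y))\<^sup>2 = (norm x)\<^sup>2 + 2 * Re (cinner x y) + (norm y)\<^sup>2"
  using Re_cinner_commute[of x y]
  by (simp add: Re_cinner_self[symmetric] cinner_add_left cinner_add_right)

lemma norm_diff_sq:
  fixes x y :: "'a::complex_inner"
  shows "(norm (x - y))\<^sup>2 = (norm x)\<^sup>2 - 2 * Re (cinner x y) + (norm y)\<^sup>2"
  using Re_cinner_commute[of x y]
  by (simp add: Re_cinner_self[symmetric] cinner_diff_left cinner_diff_right)

lemma norm_cscale:
  fixes x :: "'a::complex_inner"
  shows "norm (cscale a x) = cmod a * norm x"
proof -
  have "cinner (cscale a x) (cscale a x) = (a * cnj a) * cinner x x"
    by (simp add: cinner_cscale_left cinner_cscale_right)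
  then have "complex_of_real ((norm (cscale a x))\<^sup>2) = complex_of_real ((cmod a * norm x)\<^sup>2)"
    by (simp add: cinner_self complex_norm_square[symmetric] power_mult_distrib)
  then have "(norm (cscale a x))\<^sup>2 = (cmod a * norm x)\<^sup>2"
    by (simp only: of_real_eq_iff)
  then show ?thesis
    by (simp add: power2_eq_iff_nonneg)
qed

lemma cmod_cinner_le:
  fixes x y :: "'a::complex_inner"
  shows "cmod (cinner x y) \<le> norm x * norm y"
proof (cases "x = 0")
  case False
  define n where "n = norm x"
  have n: "n > 0"
    unfolding n_def using False cinner_self_eq_zero cinner_self by fastforce
  \<comment> \<open>The coefficient of the projection of \<open>y\<close> onto the line through
    \<open>x\<close>; the residual has a nonnegative squared norm, which is the claim.\<close>
  define t where "t = cinner x y / complex_of_real (n\<^sup>2)"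
  have "0 \<le> (norm (y - cscale t x))\<^sup>2" by simp
  also have "\<dots> = (norm y)\<^sup>2 - 2 * Re (t * cinner y x) + (cmod t * n)\<^sup>2"
    by (simp add: norm_diff_sq norm_cscale cinner_cscale_right n_def)
  also have "t * cinner y x = complex_of_real ((cmod (cinner x y))\<^sup>2 / n\<^sup>2)"
    unfolding t_def cinner_commute[of y x] using complex_norm_square[of "cinner x y"] by simp
  also have "(cmod t * n)\<^sup>2 = (cmod (cinner x y))\<^sup>2 / n\<^sup>2"
    using n by (simp add: t_def norm_divide power_divide power_mult_distrib power2_eq_square norm_mult)
  finally have "(cmod (cinner x y))\<^sup>2 / n\<^sup>2 \<le> (norm y)\<^sup>2"
    by simp
  then have "(cmod (cinner x y))\<^sup>2 \<le> (norm x * norm y)\<^sup>2"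
    using n by (simp add: field_simps n_def)
  then show ?thesis
    by (simp add: abs_le_square_iff[symmetric])
qed simp

lemma cinner_ext:
  fixes x y :: "'a::complex_inner"
  assumes "\<And>z. cinner x z = cinner y z"
  shows "x = y"
proof -
  have "cinner (x - y) (x - y) = 0"
    by (simp only: cinner_diff_left assms) simp
  then show ?thesis by (simp add: cinner_self_eq_zero)
qed

lemma bounded_linear_cinner_right: "bounded_linear (cinner (x::'a::complex_inner))"
proof (rule bounded_linear_intro[where K = "norm x"])
  show "cinner x (y + z) = cinner x y + cinner x z" for y z
    by (rule cinner_add_right)
  show "cinner x (r *\<^sub>R y) = r *\<^sub>R cinner x y" for r y
    by (simp add: scaleR_cscale cinner_cscale_right scaleR_conv_of_real)
  show "norm (cinner x y) \<le> norm y * norm x" for y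
    using cmod_cinner_le[of x y] by (simp add: mult.commute)
qed

lemma bounded_linear_cinner_left: "bounded_linear (\<lambda>x. cinner x (y::'a::complex_inner))"
  using bounded_linear_compose[OF bounded_linear_cnj bounded_linear_cinner_right[of y]]
  by (simp add: cinner_commute[of _ y])

lemma bounded_linear_cscale: "bounded_linear (cscale a :: 'a::complex_inner \<Rightarrow> 'a)"
proof (rule bounded_linear_intro[where K = "cmod a"])
  show "cscale a (r *\<^sub>R y) = r *\<^sub>R cscale a y" for r and y :: 'a
    by (simp add: scaleR_cscale cscale_cscale mult.commute)
qed (simp_all add: cscale_add_right norm_cscale)

lemmas tendsto_cinner_left = bounded_linear.tendsto[OF bounded_linear_cinner_left]
lemmas tendsto_cinner_right = bounded_linear.tendsto[OF bounded_linear_cinner_right]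
lemmas tendsto_cscale = bounded_linear.tendsto[OF bounded_linear_cscale]

lemma csubspaceD:
  assumes "csubspace S"
  shows "0 \<in> S" "x \<in> S \<Longrightarrow> y \<in> S \<Longrightarrow> x + y \<in> S" "x \<in> S \<Longrightarrow> cscale c x \<in> S"
    "x \<in> S \<Longrightarrow> - x \<in> S" "x \<in> S \<Longrightarrow> y \<in> S \<Longrightarrow> x - y \<in> S"
proof -
  show *: "0 \<in> S" "x \<in> S \<Longrightarrow> y \<in> S \<Longrightarrow> x + y \<in> S" "x \<in> S \<Longrightarrow> cscale c x \<in> S" for x y c
    using assms by (auto simp: csubspace_def)
  show m: "x \<in> S \<Longrightarrow> - x \<in> S" for x
    using *(3)[of x "- 1"] by (simp add: cscale_minus_one)
  show "x \<in> S \<Longrightarrow> y \<in> S \<Longrightarrow> x - y \<in> S"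
    using *(2)[OF _ m, of x y] by simp
qed

section \<open>Orthogonal projections\<close>

lemma projection_exists:
  fixes M :: "'a::chilbert_space set"
  assumes M: "closed_csubspace M"
  shows "\<exists>y\<in>M. \<forall>z\<in>M. cinner (x - y) z = 0"
proof -
  have sub: "csubspace M" and cl: "closed M"
    using M by (auto simp: closed_csubspace_def)
  define d where "d = infdist x M"
  have ne: "M \<noteq> {}" using csubspaceD(1)[OF sub] by auto
  have d_le: "d \<le> norm (x - y)" if "y \<in> M" for y
    using infdist_le[OF that, of x] by (simp add: d_def dist_norm)
  have d0: "d \<ge> 0" by (simp add: d_def infdist_nonneg)
  have "\<exists>y\<in>M. norm (x - y) < d + inverse (Suc n)" for n
  proof -
    have "d < d + inverse (Suc n)" by simp
    then show ?thesis
      using cInf_lessD[of "dist x ` M" "d + inverse (Suc n)"] ne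
      unfolding d_def infdist_def by (auto simp: dist_norm)
  qed
  then obtain y where yM: "\<And>n. y n \<in> M" and y: "\<And>n. norm (x - y n) < d + inverse (Suc n)"
    by metis
  \<comment> \<open>Parallelogram law: the midpoint of \<open>y m\<close> and \<open>y n\<close>
    lies in \<open>M\<close>, hence is at distance at least \<open>d\<close> from \<open>x\<close>,
    so two near-minimisers cannot be far apart.\<close>
  have par: "(norm (y m - y n))\<^sup>2 \<le> 2 * (norm (x - y m))\<^sup>2 + 2 * (norm (x - y n))\<^sup>2 - 4 * d\<^sup>2" for m n
  proof -
    define u v where "u = x - y m" and "v = x - y n"
    have "cscale (1/2) (y m + y n) \<in> M"
      using yM sub by (simp add: csubspaceD)
    then have "d \<le> norm (x - cscale (1/2) (y m + y n))"
      by (rule d_le)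
    also have "x - cscale (1/2) (y m + y n) = cscale (1/2) (u + v)"
    proof -
      have "x = cscale (1/2) (x + x)"
        using scaleR_half_double[of x] scaleR_cscale[of "1/2" "x + x"] by simp
      then show ?thesis
        unfolding u_def v_def
        by (metis (no_types, lifting) add_diff_add cscale_diff_right)
    qed
    also have "norm \<dots> = norm (u + v) / 2"
      by (simp add: norm_cscale norm_divide)
    finally have "(2 * d)\<^sup>2 \<le> (norm (u + v))\<^sup>2"
      using d0 by (intro power_mono) auto
    moreover have "(norm (u - v))\<^sup>2 + (norm (u + v))\<^sup>2 = 2 * (norm u)\<^sup>2 + 2 * (norm v)\<^sup>2"
      by (simp add: norm_add_sq norm_diff_sq)
    moreover have "norm (y m - y n) = norm (u - v)"
      by (simp add: u_def v_def norm_minus_commute)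
    ultimately show ?thesis
      unfolding u_def[symmetric] v_def[symmetric] by (simp add: power2_eq_square)
  qed
  have lim: "(\<lambda>n. (norm (x - y n))\<^sup>2) \<longlonglongrightarrow> d\<^sup>2"
  proof -
    have "(\<lambda>n. norm (x - y n)) \<longlonglongrightarrow> d"
    proof (rule tendsto_sandwich[OF _ _ tendsto_const])
      show "\<forall>\<^sub>F n in sequentially. d \<le> norm (x - y n)"
        using d_le yM by simp
      show "\<forall>\<^sub>F n in sequentially. norm (x - y n) \<le> d + inverse (Suc n)"
        using y by (simp add: less_imp_le)
      show "(\<lambda>n. d + inverse (Suc n)) \<longlonglongrightarrow> d"
        using LIMSEQ_inverse_real_of_nat_add[of d] by simp
    qed
    then show ?thesis by (rule tendsto_power)
  qed
  have "Cauchy y"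
  proof (rule metric_CauchyI)
    fix e :: real assume e: "e > 0"
    then have "e\<^sup>2 / 4 > 0" by simp
    from LIMSEQ_D[OF lim this] obtain N
      where N: "\<And>n. n \<ge> N \<Longrightarrow> \<bar>(norm (x - y n))\<^sup>2 - d\<^sup>2\<bar> < e\<^sup>2 / 4" by auto
    have "dist (y m) (y n) < e" if "m \<ge> N" "n \<ge> N" for m n
    proof -
      have "(norm (y m - y n))\<^sup>2 < e\<^sup>2"
        using par[of m n] N[OF that(1)] N[OF that(2)] by linarith
      then show ?thesis
        using e by (simp add: dist_norm power2_less_imp_less)
    qed
    then show "\<exists>N. \<forall>m\<ge>N. \<forall>n\<ge>N. dist (y m) (y n) < e" by blast
  qed
  then obtain p where p: "y \<longlonglongrightarrow> p"
    by (auto simp: Cauchy_convergent_iff convergent_def)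
  have pM: "p \<in> M"
    using closed_sequentially[OF cl] yM p by blast
  have "(\<lambda>n. (norm (x - y n))\<^sup>2) \<longlonglongrightarrow> (norm (x - p))\<^sup>2"
    by (intro tendsto_intros p)
  then have pd: "(norm (x - p))\<^sup>2 = d\<^sup>2"
    using lim LIMSEQ_unique by blast
  have "cinner (x - p) z = 0" if z: "z \<in> M" for z
  proof (cases "z = 0")
    case False
    define w where "w = x - p"
    \<comment> \<open>This \<open>t\<close> minimises the distance from \<open>x\<close> to
      \<open>p + cscale t z\<close>, lowering its square by
      \<open>(cmod (cinner z w))\<^sup>2 / (norm z)\<^sup>2\<close>. As \<open>p\<close> is already
      nearest, this gain is zero.\<close>
    define t where "t = cinner z w / complex_of_real ((norm z)\<^sup>2)"
    have nz: "norm z > 0" using False by simp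
    have "d \<le> norm (x - (p + cscale t z))"
      using z pM sub by (intro d_le) (simp add: csubspaceD)
    then have "(norm w)\<^sup>2 \<le> (norm (w - cscale t z))\<^sup>2"
      using d0 pd by (simp add: w_def diff_diff_add power_mono)
    also have "\<dots> = (norm w)\<^sup>2 - 2 * Re (t * cinner w z) + (cmod t * norm z)\<^sup>2"
      by (simp add: norm_diff_sq norm_cscale cinner_cscale_right)
    also have "t * cinner w z = complex_of_real ((cmod (cinner z w))\<^sup>2 / (norm z)\<^sup>2)"
      unfolding t_def cinner_commute[of w z] using complex_norm_square[of "cinner z w"] by simp
    also have "(cmod t * norm z)\<^sup>2 = (cmod (cinner z w))\<^sup>2 / (norm z)\<^sup>2"
      using nz by (simp add: t_def norm_divide power_divide power_mult_distrib power2_eq_square norm_mult)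
    finally have "(cmod (cinner z w))\<^sup>2 / (norm z)\<^sup>2 \<le> 0" by simp
    then have "cinner z w = 0"
      using nz by (simp add: divide_le_0_iff)
    then show ?thesis
      using cinner_commute[of w z] by (simp add: w_def)
  qed simp
  with pM show ?thesis by blast
qed

lemma projection_unique:
  fixes M :: "'a::complex_inner set"
  assumes M: "csubspace M" and "y \<in> M" "y' \<in> M"
    and "\<And>z. z \<in> M \<Longrightarrow> cinner (x - y) z = 0" "\<And>z. z \<in> M \<Longrightarrow> cinner (x - y') z = 0"
  shows "y = y'"
proof -
  have "cinner (y - y') (y - y') = cinner (x - y') (y - y') - cinner (x - y) (y - y')"
    by (simp add: cinner_diff_left)
  also have "\<dots> = 0"
    using assms csubspaceD(5)[OF M] by simp
  finally show ?thesis by (simp add: cinner_self_eq_zero)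
qed

lemma orth_proj_eqI:
  fixes M :: "'a::complex_inner set"
  assumes "csubspace M" "y \<in> M" "\<And>z. z \<in> M \<Longrightarrow> cinner (x - y) z = 0"
  shows "orth_proj M x = y"
  unfolding orth_proj_def using assms projection_unique[OF assms(1)]
  by (intro the_equality) blast+

context
  fixes M :: "'a::chilbert_space set"
  assumes M: "closed_csubspace M"
begin

private lemma sub: "csubspace M"
  using M by (simp add: closed_csubspace_def)

lemma orth_proj_in: "orth_proj M x \<in> M"
  and orth_proj_orth: "z \<in> M \<Longrightarrow> cinner (x - orth_proj M x) z = 0"
proof -
  obtain y where "y \<in> M" "\<forall>z\<in>M. cinner (x - y) z = 0"
    using projection_exists[OF M] by blast
  moreover from this have "orth_proj M x = y"
    by (intro orth_proj_eqI[OF sub]) auto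
  ultimately show "orth_proj M x \<in> M" "z \<in> M \<Longrightarrow> cinner (x - orth_proj M x) z = 0"
    by auto
qed

lemma orth_proj_orth': "z \<in> M \<Longrightarrow> cinner z (x - orth_proj M x) = 0"
  using orth_proj_orth cinner_commute by (metis complex_cnj_zero)

lemma orth_proj_id: "x \<in> M \<Longrightarrow> orth_proj M x = x"
  by (intro orth_proj_eqI[OF sub]) auto

lemma orth_proj_selfadjoint: "cinner (orth_proj M x) y = cinner x (orth_proj M y)"
proof -
  have "cinner (orth_proj M x) y = cinner (orth_proj M x) (orth_proj M y)"
    using orth_proj_orth'[OF orth_proj_in, of x y] by (simp add: cinner_diff_right)
  also have "\<dots> = cinner x (orth_proj M y)"
    using orth_proj_orth[OF orth_proj_in, of x y] by (simp add: cinner_diff_left)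
  finally show ?thesis .
qed

lemma norm_orth_proj_le: "norm (orth_proj M x) \<le> norm x"
proof -
  have "(norm (orth_proj M x + (x - orth_proj M x)))\<^sup>2 \<ge> (norm (orth_proj M x))\<^sup>2"
    unfolding norm_add_sq using orth_proj_orth'[OF orth_proj_in, of x x] by simp
  then show ?thesis by (simp add: abs_le_square_iff[symmetric])
qed

lemma orth_proj_eq_zero_iff: "orth_proj M x = 0 \<longleftrightarrow> (\<forall>z\<in>M. cinner x z = 0)"
  using orth_proj_orth[of _ x] orth_proj_eqI[OF sub csubspaceD(1)[OF sub], of x]
  by force

lemma bounded_clin_orth_proj: "bounded_clin (orth_proj M)"
  unfolding bounded_clin_def
proof (intro conjI allI exI)
  show "orth_proj M (x + y) = orth_proj M x + orth_proj M y" for x y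
    by (rule orth_proj_eqI[OF sub])
       (simp_all add: csubspaceD(2)[OF sub] orth_proj_in add_diff_add cinner_add_left orth_proj_orth)
  show "orth_proj M (cscale c x) = cscale c (orth_proj M x)" for c x
    by (rule orth_proj_eqI[OF sub])
       (simp_all add: csubspaceD(3)[OF sub] orth_proj_in cinner_cscale_left orth_proj_orth
          flip: cscale_diff_right)
  show "norm (orth_proj M x) \<le> 1 * norm x" for x
    using norm_orth_proj_le by simp
qed

end

section \<open>Bounded operators and adjoints\<close>

lemma bounded_clinD:
  assumes "bounded_clin A"
  shows "A (x + y) = A x + A y" "A (cscale c x) = cscale c (A x)" "A 0 = 0"
    "A (- x) = - A x" "A (x - y) = A x - A y"
proof -
  show add: "A (x + y) = A x + A y" and sc: "A (cscale c x) = cscale c (A x)" for x y c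
    using assms by (auto simp: bounded_clin_def)
  show "A 0 = 0" using sc[of 0 0] by simp
  show m: "A (- x) = - A x" for x using sc[of "- 1" x] by (simp add: cscale_minus_one)
  show "A (x - y) = A x - A y" using add[of x "- y"] by (simp add: m)
qed

lemma bounded_clin_bound:
  assumes "bounded_clin A"
  shows "\<exists>K>0. \<forall>x. norm (A x) \<le> K * norm x"
proof -
  obtain K where K: "norm (A x) \<le> K * norm x" for x
    using assms by (auto simp: bounded_clin_def)
  have "norm (A x) \<le> max K 1 * norm x" for x
    using K[of x] mult_right_mono[of K "max K 1" "norm x"] by simp
  then show ?thesis by (intro exI[of _ "max K 1"]) simp
qed

lemma bounded_clin_imp_bounded_linear:
  assumes "bounded_clin A"
  shows "bounded_linear A"
proof -
  obtain K where "norm (A x) \<le> K * norm x" for x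
    using bounded_clin_bound[OF assms] by blast
  then show ?thesis
    by (intro bounded_linear_intro[where K = K])
       (simp_all add: bounded_clinD[OF assms] scaleR_cscale mult.commute)
qed

lemma bounded_clinI:
  assumes "\<And>x y. A (x + y) = A x + A y" "\<And>c x. A (cscale c x) = cscale c (A x)"
    "\<And>x. norm (A x) \<le> K * norm x"
  shows "bounded_clin A"
  using assms unfolding bounded_clin_def by blast

lemma bounded_clin_compose:
  assumes "bounded_clin A" "bounded_clin B"
  shows "bounded_clin (\<lambda>x. A (B x))"
proof -
  obtain K where K: "K > 0" "\<And>x. norm (A x) \<le> K * norm x"
    using bounded_clin_bound[OF assms(1)] by blast
  obtain L where L: "\<And>x. norm (B x) \<le> L * norm x"
    using bounded_clin_bound[OF assms(2)] by blast
  have "norm (A (B x)) \<le> (K * L) * norm x" for x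
  proof -
    have "norm (A (B x)) \<le> K * norm (B x)" by (rule K)
    also have "\<dots> \<le> K * (L * norm x)" using K(1) by (intro mult_left_mono L) simp
    finally show ?thesis by (simp only: mult.assoc)
  qed
  then show ?thesis
    by (intro bounded_clinI) (simp_all add: bounded_clinD[OF assms(1)] bounded_clinD[OF assms(2)])
qed

lemma bounded_clin_add:
  assumes "bounded_clin A" "bounded_clin B"
  shows "bounded_clin (\<lambda>x. A x + B x)"
proof -
  obtain K where K: "\<And>x. norm (A x) \<le> K * norm x"
    using bounded_clin_bound[OF assms(1)] by blast
  obtain L where L: "\<And>x. norm (B x) \<le> L * norm x"
    using bounded_clin_bound[OF assms(2)] by blast
  have "norm (A x + B x) \<le> (K + L) * norm x" for x
    using norm_triangle_ineq[of "A x" "B x"] K[of x] L[of x] by (simp add: distrib_right)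
  then show ?thesis
    by (intro bounded_clinI) (simp_all add: bounded_clinD[OF assms(1)] bounded_clinD[OF assms(2)] cscale_add_right)
qed

lemma bounded_clin_id: "bounded_clin (\<lambda>x. x)"
  by (rule bounded_clinI[where K = 1]) auto

lemma bounded_clin_zero: "bounded_clin (\<lambda>x. 0)"
  by (rule bounded_clinI[where K = 1]) auto

lemma bounded_clin_cscale:
  assumes "bounded_clin A"
  shows "bounded_clin (\<lambda>x. cscale c (A x))"
proof (rule bounded_clin_compose[OF _ assms])
  show "bounded_clin (cscale c :: 'a \<Rightarrow> 'a)"
    by (rule bounded_clinI[where K = "cmod c"])
       (simp_all add: cscale_add_right cscale_cscale mult.commute norm_cscale)
qed

lemma bounded_clin_diff:
  assumes "bounded_clin A" "bounded_clin B"
  shows "bounded_clin (\<lambda>x. A x - B x)"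
  using bounded_clin_add[OF assms(1) bounded_clin_cscale[OF assms(2), of "- 1"]]
  by (simp add: cscale_minus_one)

lemma closed_csubspace_kernel:
  assumes "bounded_clin A"
  shows "closed_csubspace {x. A x = 0}"
  unfolding closed_csubspace_def csubspace_def
  using closed_Collect_eq[OF linear_continuous_on[OF bounded_clin_imp_bounded_linear[OF assms]]
      continuous_on_const]
  by (auto simp: bounded_clinD[OF assms])

lemma closed_csubspace_Int:
  "closed_csubspace M \<Longrightarrow> closed_csubspace L \<Longrightarrow> closed_csubspace (M \<inter> L)"
  by (auto simp: closed_csubspace_def csubspace_def)

text \<open>A vector \<open>w\<close> orthogonal to the kernel with \<open>f w\<close> nonzero spans
  its complement: subtracting \<open>f x / f w\<close> times \<open>w\<close> from \<open>x\<close>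
  lands in the kernel, so \<open>cinner w x\<close> is a fixed multiple of
  \<open>f x\<close>.\<close>

lemma riesz_representation:
  fixes f :: "'a::chilbert_space \<Rightarrow> complex"
  assumes add: "\<And>x y. f (x + y) = f x + f y" and sc: "\<And>c x. f (cscale c x) = c * f x"
    and bd: "\<And>x. cmod (f x) \<le> K * norm x"
  shows "\<exists>z. \<forall>x. f x = cinner z x"
proof (cases "\<forall>x. f x = 0")
  case True
  then show ?thesis by (intro exI[of _ 0]) simp
next
  case False
  then obtain x0 where x0: "f x0 \<noteq> 0" by blast
  have minus: "f (x - y) = f x - f y" for x y
    using add[of "x - y" y] by simp
  have "bounded_linear f"
    by (rule bounded_linear_intro[where K = K])
       (simp_all add: add scaleR_cscale sc scaleR_conv_of_real bd mult.commute)
  then have "closed {x. f x = 0}"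
    by (intro closed_Collect_eq linear_continuous_on continuous_on_const)
  moreover have "f 0 = 0" using minus[of 0 0] by simp
  ultimately have M: "closed_csubspace {x. f x = 0}"
    by (auto simp: closed_csubspace_def csubspace_def add sc)
  define w where "w = x0 - orth_proj {x. f x = 0} x0"
  have fw: "f w = f x0"
    using orth_proj_in[OF M, of x0] by (simp add: w_def minus)
  have w: "cinner w z = 0" if "f z = 0" for z
    using orth_proj_orth[OF M, of z x0] that by (simp add: w_def)
  have w0: "norm w \<noteq> 0"
    using fw x0 \<open>f 0 = 0\<close> by auto
  have "f x = cinner (cscale (cnj (f w) / (norm w)\<^sup>2) w) x" for x
  proof -
    have "f (x - cscale (f x / f w) w) = 0"
      using fw x0 by (simp add: minus sc)
    from w[OF this] have "cinner w x = f x / f w * (norm w)\<^sup>2"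
      by (simp add: cinner_diff_right cinner_cscale_right cinner_self)
    then show ?thesis
      using w0 fw x0 by (simp add: cinner_cscale_left)
  qed
  then show ?thesis by blast
qed

text \<open>Riesz representation of \<open>\<lambda>x. cinner y (A x)\<close> yields the value at
  \<open>y\<close>. Linearity follows by testing against all vectors, and the bound from writing the
  square of \<open>norm (B x)\<close> as the real part of \<open>cinner (A (B x)) x\<close>.\<close>

lemma adjoint_exists:
  fixes A :: "'a::chilbert_space \<Rightarrow> 'a"
  assumes A: "bounded_clin A"
  shows "\<exists>B. bounded_clin B \<and> (\<forall>x y. cinner (A x) y = cinner x (B y))"
proof -
  obtain K where K: "K > 0" "\<And>x. norm (A x) \<le> K * norm x"
    using bounded_clin_bound[OF A] by blast
  have "\<exists>z. \<forall>x. cinner y (A x) = cinner z x" for y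
  proof (rule riesz_representation[where K = "norm y * K"])
    show "cmod (cinner y (A x)) \<le> norm y * K * norm x" for x
      using cmod_cinner_le[of y "A x"] mult_left_mono[OF K(2)[of x], of "norm y"] by simp
  qed (simp_all add: bounded_clinD[OF A] cinner_add_right cinner_cscale_right)
  then obtain B where B: "\<And>x y. cinner y (A x) = cinner (B y) x" by metis
  have adj: "cinner (A x) y = cinner x (B y)" for x y
    using B[of y x] cinner_commute[of "A x" y] cinner_commute[of x "B y"] by simp
  have "bounded_clin B"
  proof (rule bounded_clinI[where K = K])
    show "B (x + y) = B x + B y" for x y
      by (rule cinner_ext) (simp add: cinner_add_left flip: B)
    show "B (cscale c x) = cscale c (B x)" for c x
      by (rule cinner_ext) (simp add: cinner_cscale_left flip: B)
    show "norm (B x) \<le> K * norm x" for x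
    proof (cases "B x = 0")
      case False
      have "(norm (B x))\<^sup>2 = Re (cinner (A (B x)) x)"
        by (simp add: adj Re_cinner_self)
      also have "\<dots> \<le> norm (A (B x)) * norm x"
        using complex_Re_le_cmod cmod_cinner_le order_trans by blast
      also have "\<dots> \<le> (K * norm (B x)) * norm x"
        by (intro mult_right_mono K) simp
      finally show ?thesis
        using False by (simp add: power2_eq_square)
    qed (use K in simp)
  qed
  with adj show ?thesis by blast
qed

definition symmetric_op :: "('a::complex_inner \<Rightarrow> 'a) \<Rightarrow> bool" where
  "symmetric_op A \<longleftrightarrow> (\<forall>x y. cinner (A x) y = cinner x (A y))"

lemma symmetric_opD: "symmetric_op A \<Longrightarrow> cinner (A x) y = cinner x (A y)"
  by (simp add: symmetric_op_def)

section \<open>The modulus of a symmetric contraction\<close>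

text \<open>The iterates converge to a solution of \<open>Y = (C + Y\<^sup>2) / 2\<close>, so \<open>1 - Y\<close> is a square root
  of \<open>1 - C\<close>.\<close>

primrec sqrt_iter :: "('a::complex_inner \<Rightarrow> 'a) \<Rightarrow> nat \<Rightarrow> 'a \<Rightarrow> 'a" where
  "sqrt_iter C 0 = (\<lambda>x. 0)"
| "sqrt_iter C (Suc n) = (\<lambda>x. cscale (1/2) (C x + sqrt_iter C n (sqrt_iter C n x)))"

text \<open>The same recursion with \<open>C\<close> replaced by its norm bound 1. It increases
  because \<open>(1 - y)\<^sup>2\<close> is nonnegative, and it stays below the double root 1 of its
  fixed-point equation.\<close>

primrec sqrt_majorant :: "nat \<Rightarrow> real" where
  "sqrt_majorant 0 = 0"
| "sqrt_majorant (Suc n) = (1 + (sqrt_majorant n)\<^sup>2) / 2"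

lemma sqrt_majorant_bounds: "0 \<le> sqrt_majorant n" "sqrt_majorant n \<le> 1"
proof -
  have "0 \<le> sqrt_majorant n \<and> sqrt_majorant n \<le> 1"
    by (induction n) (auto simp: power_le_one)
  then show "0 \<le> sqrt_majorant n" "sqrt_majorant n \<le> 1" by auto
qed

lemma incseq_sqrt_majorant: "incseq sqrt_majorant"
proof (rule incseq_SucI)
  fix n
  have "0 \<le> (1 - sqrt_majorant n)\<^sup>2" by simp
  then show "sqrt_majorant n \<le> sqrt_majorant (Suc n)"
    by (simp add: power2_diff)
qed

lemma Cauchy_sqrt_majorant: "Cauchy sqrt_majorant"
proof -
  obtain L where "sqrt_majorant \<longlonglongrightarrow> L"
    by (rule incseq_convergent[OF incseq_sqrt_majorant, of 1]) (auto simp: sqrt_majorant_bounds)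
  then show ?thesis by (rule LIMSEQ_imp_Cauchy)
qed

lemma bounded_clin_sqrt_iter: "bounded_clin C \<Longrightarrow> bounded_clin (sqrt_iter C n)"
  by (induction n)
     (simp_all add: bounded_clin_zero bounded_clin_cscale bounded_clin_add bounded_clin_compose)

text \<open>The difference of two squares of iterates splits as
  \<open>(Y k - Y m) (Y k) + Y m (Y k - Y m)\<close>, with products read as compositions. Estimating
  both parts reproduces the difference of the squared scalars, so only norms are compared and no
  operator inequality is involved. The vector stays arbitrary in the induction because the
  hypothesis is also applied at \<open>Y k x\<close>.\<close>

lemma norm_sqrt_iter_diff:
  assumes C: "bounded_clin C" and nC: "\<And>x. norm (C x) \<le> norm x"
  shows "m \<le> n \<Longrightarrow>
    norm (sqrt_iter C n x - sqrt_iter C m x) \<le> (sqrt_majorant n - sqrt_majorant m) * norm x"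
proof -
  let ?Y = "sqrt_iter C" and ?y = sqrt_majorant
  have bd: "norm (?Y n x) \<le> ?y n * norm x" for n x
  proof (induction n arbitrary: x)
    case (Suc n)
    have "norm (?Y n (?Y n x)) \<le> ?y n * (?y n * norm x)"
      using Suc[of "?Y n x"] mult_left_mono[OF Suc[of x] sqrt_majorant_bounds(1)[of n]] by linarith
    then have "norm (C x + ?Y n (?Y n x)) \<le> norm x + (?y n)\<^sup>2 * norm x"
      using norm_triangle_ineq[of "C x" "?Y n (?Y n x)"] nC[of x] by (simp add: power2_eq_square)
    then show ?case
      by (simp add: norm_cscale norm_divide distrib_right add_divide_distrib)
  qed simp
  show "norm (?Y n x - ?Y m x) \<le> (?y n - ?y m) * norm x" if "m \<le> n"
    using that
  proof (induction m arbitrary: n x)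
    case 0
    then show ?case using bd[of n x] by simp
  next
    case (Suc m)
    then obtain k where n: "n = Suc k" and k: "m \<le> k" by (cases n) auto
    have d: "0 \<le> ?y k - ?y m"
      using incseq_sqrt_majorant k by (simp add: incseq_def)
    have "norm (?Y k (?Y k x) - ?Y m (?Y k x)) \<le> (?y k - ?y m) * (?y k * norm x)"
      using Suc.IH[OF k, of "?Y k x"] mult_left_mono[OF bd[of k x] d] by linarith
    moreover have "norm (?Y m (?Y k x - ?Y m x)) \<le> ?y m * ((?y k - ?y m) * norm x)"
      using bd[of m "?Y k x - ?Y m x"]
        mult_left_mono[OF Suc.IH[OF k, of x] sqrt_majorant_bounds(1)[of m]] by linarith
    moreover have eq: "?Y n x - ?Y (Suc m) x
        = cscale (1/2) ((?Y k (?Y k x) - ?Y m (?Y k x)) + ?Y m (?Y k x - ?Y m x))"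
      unfolding n by (simp add: cscale_diff_right[symmetric] bounded_clinD[OF bounded_clin_sqrt_iter[OF C]])
    moreover have "norm (cscale (1/2) (u + v)) \<le> (a + b) / 2"
      if "norm u \<le> a" "norm v \<le> b" for u v :: 'a and a b
      using norm_triangle_ineq[of u v] that by (simp add: norm_cscale norm_divide)
    ultimately have "norm (?Y n x - ?Y (Suc m) x)
        \<le> ((?y k - ?y m) * (?y k * norm x) + ?y m * ((?y k - ?y m) * norm x)) / 2"
      by (simp only: eq)
    also have "\<dots> = (?y n - ?y (Suc m)) * norm x"
      unfolding n by (simp add: field_simps power2_eq_square)
    finally show ?case .
  qed
qed

text \<open>Each iterate is a polynomial in \<open>C\<close>, so symmetry, commutation with whatever
  commutes with \<open>C\<close>, and preservation of closed subspaces invariant under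
  \<open>C\<close> hold for all iterates and survive the pointwise limit.\<close>

lemma sqrt_fixpoint_exists:
  fixes C :: "'a::chilbert_space \<Rightarrow> 'a"
  assumes C: "bounded_clin C" and nC: "\<And>x. norm (C x) \<le> norm x" and sC: "symmetric_op C"
  obtains Y where "bounded_clin Y" "symmetric_op Y" "\<And>x. norm (Y x) \<le> norm x"
    "\<And>x. cscale 2 (Y x) = C x + Y (Y x)"
    "\<And>W x. bounded_clin W \<Longrightarrow> (\<And>x. W (C x) = C (W x)) \<Longrightarrow> W (Y x) = Y (W x)"
    "\<And>M x. closed_csubspace M \<Longrightarrow> C ` M \<subseteq> M \<Longrightarrow> x \<in> M \<Longrightarrow> Y x \<in> M"
proof -
  let ?Y = "sqrt_iter C" and ?y = sqrt_majorant
  note lin = bounded_clinD[OF bounded_clin_sqrt_iter[OF C]]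
  have "Cauchy (\<lambda>n. ?Y n x)" for x
  proof (rule CauchyI')
    fix e :: real assume e: "e > 0"
    \<comment> \<open>Adding 1 keeps the denominator positive when \<open>x\<close> is zero.\<close>
    then have "e / (norm x + 1) > 0" by (simp add: add_nonneg_pos)
    then obtain N where N: "\<And>m n. m \<ge> N \<Longrightarrow> n \<ge> N \<Longrightarrow> \<bar>?y m - ?y n\<bar> < e / (norm x + 1)"
      using Cauchy_sqrt_majorant unfolding Cauchy_def dist_real_def by blast
    have "dist (?Y m x) (?Y n x) < e" if "m \<ge> N" "m < n" for m n
    proof -
      have "dist (?Y m x) (?Y n x) \<le> (?y n - ?y m) * norm x"
        using norm_sqrt_iter_diff[OF C nC, of m n x] that by (simp add: dist_norm norm_minus_commute)
      also have "\<dots> \<le> (e / (norm x + 1)) * norm x"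
        using N[of m n] that by (intro mult_right_mono) auto
      also have "\<dots> < e"
        using e by (simp add: divide_less_eq add_nonneg_pos distrib_left)
      finally show ?thesis .
    qed
    then show "\<exists>M. \<forall>m\<ge>M. \<forall>n>m. dist (?Y m x) (?Y n x) < e" by blast
  qed
  then have "\<exists>l. (\<lambda>n. ?Y n x) \<longlonglongrightarrow> l" for x
    by (simp add: Cauchy_convergent_iff convergent_def)
  then obtain Y where lim: "\<And>x. (\<lambda>n. ?Y n x) \<longlonglongrightarrow> Y x" by metis
  have nYn: "norm (?Y n x) \<le> norm x" for n x
    using norm_sqrt_iter_diff[OF C nC, of 0 n x] sqrt_majorant_bounds[of n]
      mult_right_mono[of "?y n" 1 "norm x"] by simp
  have nY: "norm (Y x) \<le> norm x" for x
    by (rule tendsto_upperbound[OF tendsto_norm[OF lim]]) (auto simp: nYn)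
  have bY: "bounded_clin Y"
  proof (rule bounded_clinI[where K = 1])
    show "Y (x + y) = Y x + Y y" for x y
      by (rule LIMSEQ_unique[OF lim]) (simp add: lin tendsto_add lim)
    show "Y (cscale c x) = cscale c (Y x)" for c x
      by (rule LIMSEQ_unique[OF lim]) (simp add: lin tendsto_cscale lim)
  qed (simp add: nY)
  have sYn: "cinner (?Y n x) y = cinner x (?Y n y)" for n x y
    by (induction n arbitrary: x y)
       (auto simp: cinner_add_left cinner_add_right cinner_cscale_left cinner_cscale_right
          symmetric_opD[OF sC])
  have sY: "symmetric_op Y"
    unfolding symmetric_op_def
  proof (intro allI)
    fix x y
    show "cinner (Y x) y = cinner x (Y y)"
      using LIMSEQ_unique[OF tendsto_cinner_left[OF lim, of x y]]
        tendsto_cinner_right[OF lim, of x y] by (simp add: sYn)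
  qed
  \<comment> \<open>Pointwise limits need not respect composition; here the common bound 1 on the
    iterates forces \<open>?Y n (?Y n x - Y x)\<close> to tend to zero.\<close>
  have lim2: "(\<lambda>n. ?Y n (?Y n x)) \<longlonglongrightarrow> Y (Y x)" for x
  proof -
    have "(\<lambda>n. ?Y n (?Y n x - Y x)) \<longlonglongrightarrow> 0"
    proof (rule Lim_null_comparison)
      show "(\<lambda>n. norm (?Y n x - Y x)) \<longlonglongrightarrow> 0"
        using lim[of x] by (simp add: LIM_zero tendsto_norm_zero)
    qed (simp add: nYn)
    from tendsto_add[OF this lim[of "Y x"]] show ?thesis by (simp add: lin)
  qed
  have fixp: "cscale 2 (Y x) = C x + Y (Y x)" for x
  proof -
    have "(\<lambda>n. ?Y (Suc n) x) \<longlonglongrightarrow> cscale (1/2) (C x + Y (Y x))"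
      by (auto intro!: tendsto_cscale tendsto_add lim2)
    then have "Y x = cscale (1/2) (C x + Y (Y x))"
      using LIMSEQ_unique LIMSEQ_Suc[OF lim[of x]] by blast
    then have "cscale 2 (Y x) = cscale 2 (cscale (1/2) (C x + Y (Y x)))" by simp
    then show ?thesis by (simp only: cscale_cscale) (simp add: cscale_one)
  qed
  have comm: "W (Y x) = Y (W x)" if W: "bounded_clin W" and WC: "\<And>x. W (C x) = C (W x)" for W x
  proof -
    have "W (?Y n x) = ?Y n (W x)" for n x
      by (induction n arbitrary: x) (simp_all add: bounded_clinD[OF W] WC)
    then have "(\<lambda>n. ?Y n (W x)) \<longlonglongrightarrow> W (Y x)"
      using bounded_linear.tendsto[OF bounded_clin_imp_bounded_linear[OF W] lim[of x]] by simp
    then show ?thesis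
      using LIMSEQ_unique lim by blast
  qed
  have invM: "Y x \<in> M" if M: "closed_csubspace M" and CM: "C ` M \<subseteq> M" and x: "x \<in> M" for M x
  proof -
    have sub: "csubspace M" and cl: "closed M"
      using M by (auto simp: closed_csubspace_def)
    have "?Y n x \<in> M" if "x \<in> M" for n x
      using that CM
      by (induction n arbitrary: x) (auto intro!: csubspaceD[OF sub])
    then show ?thesis
      using closed_sequentially[OF cl _ lim] x by blast
  qed
  show thesis
    by (rule that[OF bY sY nY fixp comm invM])
qed

section \<open>Schur's lemma\<close>

lemma unitary_bounded_clin: "unitary_rep G V \<Longrightarrow> g \<in> carrier G \<Longrightarrow> bounded_clin (V g)"
  by (simp add: unitary_rep_def unitary_op_def)

lemma unitary_rep_adjoint:
  assumes "unitary_rep G V" "g \<in> carrier G"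
  shows "cinner (V g x) y = cinner x (V (inv\<^bsub>G\<^esub> g) y)"
proof -
  interpret group G using assms by (simp add: unitary_rep_def)
  have "V (g \<otimes>\<^bsub>G\<^esub> inv\<^bsub>G\<^esub> g) = V g \<circ> V (inv\<^bsub>G\<^esub> g)"
    using assms inv_closed unfolding unitary_rep_def by blast
  moreover have "V \<one>\<^bsub>G\<^esub> = id"
    using assms by (simp add: unitary_rep_def)
  ultimately have "V g (V (inv\<^bsub>G\<^esub> g) y) = y"
    using assms(2) by (simp add: fun_eq_iff)
  then show ?thesis
    using assms by (metis unitary_rep_def unitary_op_def)
qed

lemma commutant_repD:
  assumes "A \<in> commutant (V ` carrier G)"
  shows "bounded_clin A" "g \<in> carrier G \<Longrightarrow> A (V g x) = V g (A x)"
  using assms by (auto simp: commutant_def fun_eq_iff)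

lemma commutant_repI:
  assumes "bounded_clin A" "\<And>g x. g \<in> carrier G \<Longrightarrow> A (V g x) = V g (A x)"
  shows "A \<in> commutant (V ` carrier G)"
  using assms by (auto simp: commutant_def fun_eq_iff)

text \<open>The kernel of a commuting operator meets \<open>M\<close> in a closed invariant
  subspace, which irreducibility leaves only two choices for.\<close>

lemma irreducible_kernel:
  assumes rep: "unitary_rep G V" and irr: "irreducible_subrep G V M"
    and A: "A \<in> commutant (V ` carrier G)"
  shows "(\<forall>x\<in>M. A x = 0) \<or> (\<forall>x\<in>M. A x = 0 \<longrightarrow> x = 0)"
proof -
  have M: "closed_csubspace M" "\<And>g x. g \<in> carrier G \<Longrightarrow> x \<in> M \<Longrightarrow> V g x \<in> M"
    using irr by (auto simp: irreducible_subrep_def invariant_subspace_def)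
  have "invariant_subspace G V (M \<inter> {x. A x = 0})"
    unfolding invariant_subspace_def
    using M closed_csubspace_Int[OF M(1) closed_csubspace_kernel] commutant_repD[OF A]
      bounded_clinD(3)[OF unitary_bounded_clin[OF rep]]
    by auto
  then have "M \<inter> {x. A x = 0} = {0} \<or> M \<inter> {x. A x = 0} = M"
    using irr by (auto simp: irreducible_subrep_def)
  then show ?thesis by blast
qed

text \<open>With \<open>S = \<bar>B\<bar>\<close> one has \<open>(S - B) (S + B) = 0\<close>, and irreducibility forces one of the factors
  to vanish.\<close>

lemma irreducible_definite:
  fixes V :: "'g \<Rightarrow> 'h::chilbert_space \<Rightarrow> 'h"
  assumes rep: "unitary_rep G V" and irr: "irreducible_subrep G V M"
    and B: "B \<in> commutant (V ` carrier G)" and sB: "symmetric_op B"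
    and nB: "\<And>x. norm (B x) \<le> norm x" and BM: "B ` M \<subseteq> M"
  shows "(\<forall>x\<in>M. 0 \<le> Re (cinner x (B x))) \<or> (\<forall>x\<in>M. Re (cinner x (B x)) \<le> 0)"
proof -
  note bB = commutant_repD(1)[OF B]
  have M: "closed_csubspace M" and sub: "csubspace M"
    using irr by (auto simp: irreducible_subrep_def invariant_subspace_def closed_csubspace_def)
  \<comment> \<open>Chosen so that the square root of \<open>1 - C\<close> is the square root of
    \<open>B\<close> squared, that is, the modulus of \<open>B\<close>.\<close>
  define C where "C = (\<lambda>x. x - B (B x))"
  have C: "bounded_clin C"
    unfolding C_def by (rule bounded_clin_diff[OF bounded_clin_id bounded_clin_compose[OF bB bB]])
  have sC: "symmetric_op C"
    by (simp add: symmetric_op_def C_def cinner_diff_left cinner_diff_right symmetric_opD[OF sB])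
  have nC: "norm (C x) \<le> norm x" for x
  proof -
    have "cinner x (B (B x)) = cinner (B x) (B x)"
      by (simp add: symmetric_opD[OF sB])
    then have "(norm (C x))\<^sup>2 = (norm x)\<^sup>2 - 2 * (norm (B x))\<^sup>2 + (norm (B (B x)))\<^sup>2"
      by (simp add: C_def norm_diff_sq Re_cinner_self)
    moreover have "(norm (B (B x)))\<^sup>2 \<le> (norm (B x))\<^sup>2"
      by (intro power_mono nB) simp
    ultimately have "(norm (C x))\<^sup>2 \<le> (norm x)\<^sup>2"
      using zero_le_power2[of "norm (B x)"] by linarith
    then show ?thesis by (simp add: abs_le_square_iff[symmetric])
  qed
  obtain Y where bY: "bounded_clin Y" and sY: "symmetric_op Y" and nY: "\<And>x. norm (Y x) \<le> norm x"
    and fixp: "\<And>x. cscale 2 (Y x) = C x + Y (Y x)"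
    and comm: "\<And>W x. bounded_clin W \<Longrightarrow> (\<And>x. W (C x) = C (W x)) \<Longrightarrow> W (Y x) = Y (W x)"
    and YM: "\<And>M x. closed_csubspace M \<Longrightarrow> C ` M \<subseteq> M \<Longrightarrow> x \<in> M \<Longrightarrow> Y x \<in> M"
    by (rule sqrt_fixpoint_exists[OF C nC sC]) blast+
  have YB: "B (Y x) = Y (B x)" for x
    by (rule comm[OF bB]) (simp add: C_def bounded_clinD[OF bB])
  have YV: "Y (V g x) = V g (Y x)" if "g \<in> carrier G" for g x
    by (rule comm[OF unitary_bounded_clin[OF rep that], symmetric])
       (simp add: C_def bounded_clinD[OF unitary_bounded_clin[OF rep that]] commutant_repD(2)[OF B that])
  have YM': "Y x \<in> M" if "x \<in> M" for x
    using BM that by (intro YM[OF M]) (auto simp: C_def intro!: csubspaceD[OF sub])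
  \<comment> \<open>The modulus of \<open>B\<close>: the fixed-point equation says that
    \<open>S\<close> squared is \<open>1 - C\<close>, and \<open>S\<close> is positive because
    \<open>Y\<close> is a contraction.\<close>
  define S where "S = (\<lambda>x. x - Y x)"
  have S_pos: "0 \<le> Re (cinner x (S x))" for x
  proof -
    have "Re (cinner x (Y x)) \<le> norm x * norm (Y x)"
      using complex_Re_le_cmod cmod_cinner_le order_trans by blast
    also have "\<dots> \<le> norm x * norm x"
      by (intro mult_left_mono nY) simp
    finally show ?thesis
      by (simp add: S_def cinner_diff_right Re_cinner_self power2_eq_square)
  qed
  have SB: "S (S x) = B (B x)" for x
  proof -
    have "S (S x) = x - (Y x + Y x) + Y (Y x)"
      by (simp add: S_def bounded_clinD[OF bY] algebra_simps)
    also have "Y x + Y x = cscale 2 (Y x)"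
      by (metis cscale_add_left cscale_one one_add_one)
    finally show ?thesis by (simp add: fixp C_def)
  qed
  \<comment> \<open>Since \<open>Y\<close> commutes with \<open>B\<close>, the product expands to
    \<open>S\<close> squared minus \<open>B\<close> squared with no mixed terms.\<close>
  have factor: "S (S x + B x) - B (S x + B x) = 0" for x
    using SB[of x] by (simp add: S_def bounded_clinD[OF bB] bounded_clinD[OF bY] YB)
  have "(\<lambda>x. S x - B x) \<in> commutant (V ` carrier G)"
    unfolding S_def
    by (intro commutant_repI bounded_clin_diff bounded_clin_id bY bB)
       (simp add: YV commutant_repD(2)[OF B] bounded_clinD[OF unitary_bounded_clin[OF rep]])
  from irreducible_kernel[OF rep irr this] show ?thesis
  proof
    assume "\<forall>x\<in>M. S x - B x = 0"
    then show ?thesis using S_pos by (metis eq_iff_diff_eq_0)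
  next
    \<comment> \<open>Injectivity of \<open>S - B\<close> on \<open>M\<close> turns the
      factorisation into \<open>S + B = 0\<close> there, so \<open>B\<close> is minus a positive
      operator.\<close>
    assume inj: "\<forall>x\<in>M. S x - B x = 0 \<longrightarrow> x = 0"
    have "B x = - S x" if "x \<in> M" for x
    proof -
      have "S x + B x \<in> M"
        using that YM' BM by (auto simp: S_def intro!: csubspaceD[OF sub])
      with inj factor[of x] show ?thesis
        by (metis add.commute add_eq_0_iff)
    qed
    then show ?thesis using S_pos by (simp add: cinner_minus_right)
  qed
qed

text \<open>The sign dichotomy for every shift \<open>A - c\<close> prevents the Rayleigh quotient
  from taking two different values on \<open>M\<close>. A symmetric operator is determined by its
  quadratic form, so it is scalar there.\<close>

lemma schur_symmetric:
  fixes V :: "'g \<Rightarrow> 'h::chilbert_space \<Rightarrow> 'h"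
  assumes rep: "unitary_rep G V" and irr: "irreducible_subrep G V M"
    and A: "A \<in> commutant (V ` carrier G)" and sA: "symmetric_op A" and AM: "A ` M \<subseteq> M"
  shows "\<exists>a::real. \<forall>x\<in>M. A x = cscale a x"
proof -
  note bA = commutant_repD(1)[OF A]
  have sub: "csubspace M"
    using irr by (auto simp: irreducible_subrep_def invariant_subspace_def closed_csubspace_def)
  obtain K where K: "K > 0" "\<And>x. norm (A x) \<le> K * norm x"
    using bounded_clin_bound[OF bA] by blast
  have dich: "(\<forall>x\<in>M. c * (norm x)\<^sup>2 \<le> Re (cinner x (A x))) \<or>
      (\<forall>x\<in>M. Re (cinner x (A x)) \<le> c * (norm x)\<^sup>2)" for c
  proof -
    \<comment> \<open>Rescaling by a bound for the norm of \<open>A - c\<close> makes the shift a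
      contraction, as the definiteness result demands; \<open>k\<close> is positive, so signs are
      kept.\<close>
    define k where "k = 1 / (K + \<bar>c\<bar>)"
    have k: "k > 0" using K(1) by (simp add: k_def add_pos_nonneg)
    define B where "B = (\<lambda>x. cscale k (A x - cscale c x))"
    have B: "B \<in> commutant (V ` carrier G)"
      unfolding B_def
      by (intro commutant_repI bounded_clin_diff bounded_clin_id bounded_clin_cscale bA)
         (simp add: commutant_repD(2)[OF A] bounded_clinD[OF unitary_bounded_clin[OF rep]])
    have sB: "symmetric_op B"
      by (simp add: symmetric_op_def B_def cinner_diff_left cinner_diff_right cinner_cscale_left
          cinner_cscale_right symmetric_opD[OF sA])
    have nB: "norm (B x) \<le> norm x" for x
    proof -
      have "norm (A x - cscale c x) \<le> (K + \<bar>c\<bar>) * norm x"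
        using norm_triangle_ineq4[of "A x" "cscale c x"] K(2)[of x]
        by (simp add: norm_cscale distrib_right)
      moreover have "K + \<bar>c\<bar> > 0"
        using K(1) by simp
      ultimately have "k * norm (A x - cscale c x) \<le> norm x"
        by (simp add: k_def divide_le_eq mult.commute)
      then show ?thesis
        using k by (simp add: B_def norm_cscale)
    qed
    have BM: "B ` M \<subseteq> M"
      using AM by (auto simp: B_def intro!: csubspaceD[OF sub])
    have "Re (cinner x (B x)) = k * (Re (cinner x (A x)) - c * (norm x)\<^sup>2)" for x
      by (simp add: B_def cinner_cscale_right cinner_diff_right cinner_self
          flip: of_real_mult of_real_power)
    with irreducible_definite[OF rep irr B sB nB BM] k show ?thesis
      by (simp add: zero_le_mult_iff mult_le_0_iff)
  qed
  obtain e where e: "e \<in> M" "e \<noteq> 0"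
    using irr csubspaceD(1)[OF sub] by (auto simp: irreducible_subrep_def)
  define a where "a = Re (cinner e (A e)) / (norm e)\<^sup>2"
  have ae: "Re (cinner e (A e)) = a * (norm e)\<^sup>2"
    using e by (simp add: a_def)
  have q: "Re (cinner x (A x)) = a * (norm x)\<^sup>2" if x: "x \<in> M" for x
  proof (cases "x = 0")
    case False
    define b where "b = Re (cinner x (A x)) / (norm x)\<^sup>2"
    have bx: "Re (cinner x (A x)) = b * (norm x)\<^sup>2"
      using False by (simp add: b_def)
    \<comment> \<open>Shifting by the midpoint of the two Rayleigh quotients puts both on the same
      side of it, which forces them to coincide.\<close>
    have "((a + b) / 2 \<le> b \<and> (a + b) / 2 \<le> a) \<or> (b \<le> (a + b) / 2 \<and> a \<le> (a + b) / 2)"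
      using dich[of "(a + b) / 2"]
    proof (elim disjE)
      assume "\<forall>z\<in>M. (a + b) / 2 * (norm z)\<^sup>2 \<le> Re (cinner z (A z))"
      from bspec[OF this x] bspec[OF this e(1)] show ?thesis
        using False e(2) by (simp only: ae bx mult_le_cancel_right) simp
    next
      assume "\<forall>z\<in>M. Re (cinner z (A z)) \<le> (a + b) / 2 * (norm z)\<^sup>2"
      from bspec[OF this x] bspec[OF this e(1)] show ?thesis
        using False e(2) by (simp only: ae bx mult_le_cancel_right) simp
    qed
    then have "a = b" by auto
    then show ?thesis by (simp add: bx)
  qed simp
  have "A x = cscale a x" if x: "x \<in> M" for x
  proof -
    define F where "F = (\<lambda>x. A x - cscale a x)"
    have bF: "bounded_clin F"
      unfolding F_def by (intro bounded_clin_diff bounded_clin_id bounded_clin_cscale bA)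
    have sF: "cinner (F x) y = cinner x (F y)" for x y
      by (simp add: F_def cinner_diff_left cinner_diff_right cinner_cscale_left
          cinner_cscale_right symmetric_opD[OF sA])
    have F0: "Re (cinner z (F z)) = 0" if "z \<in> M" for z
      using q[OF that] by (simp add: F_def cinner_diff_right cinner_cscale_right cinner_self
          flip: of_real_mult of_real_power)
    have FM: "F z \<in> M" if "z \<in> M" for z
      using that AM by (auto simp: F_def intro!: csubspaceD[OF sub])
    \<comment> \<open>Polarisation with the vector \<open>F x\<close>, which lies in
      \<open>M\<close>: the quadratic form vanishes at \<open>x\<close>, at \<open>F x\<close> and
      at their sum, and the surviving cross terms are each the squared norm of
      \<open>F x\<close>.\<close>
    have "Re (cinner (x + F x) (F (x + F x))) = 2 * (norm (F x))\<^sup>2"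
      using F0[OF x] F0[OF FM[OF x]] sF[of x "F x"] Re_cinner_self[of "F x"]
      by (simp add: bounded_clinD[OF bF] cinner_add_left cinner_add_right)
    then have "F x = 0"
      using F0[OF csubspaceD(2)[OF sub x FM[OF x]]] by simp
    then show ?thesis by (simp add: F_def)
  qed
  then show ?thesis by blast
qed

text \<open>\<open>V g\<close> maps \<open>M\<close> into itself, and it keeps
  \<open>x - orth_proj M x\<close> orthogonal to \<open>M\<close> because its adjoint,
  \<open>V\<close> at the inverse, also preserves \<open>M\<close>.\<close>

lemma orth_proj_in_commutant:
  fixes V :: "'g \<Rightarrow> 'h::chilbert_space \<Rightarrow> 'h"
  assumes rep: "unitary_rep G V" and inv: "invariant_subspace G V M"
  shows "orth_proj M \<in> commutant (V ` carrier G)"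
proof (rule commutant_repI)
  have M: "closed_csubspace M" and sub: "csubspace M"
    and VM: "\<And>g x. g \<in> carrier G \<Longrightarrow> x \<in> M \<Longrightarrow> V g x \<in> M"
    using inv by (auto simp: invariant_subspace_def closed_csubspace_def)
  show "bounded_clin (orth_proj M)" by (rule bounded_clin_orth_proj[OF M])
  interpret group G using rep by (simp add: unitary_rep_def)
  fix g x assume g: "g \<in> carrier G"
  show "orth_proj M (V g x) = V g (orth_proj M x)"
  proof (rule orth_proj_eqI[OF sub])
    fix z assume z: "z \<in> M"
    have "cinner (V g x - V g (orth_proj M x)) z = cinner (x - orth_proj M x) (V (inv\<^bsub>G\<^esub> g) z)"
      by (simp only: unitary_rep_adjoint[OF rep g, symmetric]
          bounded_clinD(5)[OF unitary_bounded_clin[OF rep g]])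
    also have "\<dots> = 0"
      using g z by (intro orth_proj_orth[OF M] VM) auto
    finally show "cinner (V g x - V g (orth_proj M x)) z = 0" .
  qed (use g VM orth_proj_in[OF M] in auto)
qed

lemma adjoint_swap:
  assumes "\<And>x y. cinner (A x) y = cinner x (B y)"
  shows "cinner (B x) y = cinner x (A y)"
  using assms[of y x] cinner_commute[of "B x" y] cinner_commute[of x "A y"] by simp

text \<open>Taking adjoints exchanges \<open>V g\<close> with \<open>V\<close> at the inverse of
  \<open>g\<close>, and the group contains both.\<close>

lemma adjoint_in_commutant:
  fixes V :: "'g \<Rightarrow> 'h::chilbert_space \<Rightarrow> 'h"
  assumes rep: "unitary_rep G V" and A: "A \<in> commutant (V ` carrier G)"
    and B: "bounded_clin B" and adj: "\<And>x y. cinner (A x) y = cinner x (B y)"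
  shows "B \<in> commutant (V ` carrier G)"
proof (rule commutant_repI[OF B], rule cinner_ext)
  interpret group G using rep by (simp add: unitary_rep_def)
  fix g x z assume g: "g \<in> carrier G"
  have "cinner (B (V g x)) z = cinner x (V (inv\<^bsub>G\<^esub> g) (A z))"
    by (simp add: adjoint_swap[OF adj] unitary_rep_adjoint[OF rep g])
  also have "\<dots> = cinner x (A (V (inv\<^bsub>G\<^esub> g) z))"
    using commutant_repD(2)[OF A] g by simp
  also have "\<dots> = cinner (V g (B x)) z"
    by (simp add: adjoint_swap[OF adj] unitary_rep_adjoint[OF rep g])
  finally show "cinner (B (V g x)) z = cinner (V g (B x)) z" .
qed

lemma commutant_rep_compose:
  assumes "A \<in> commutant (V ` carrier G)" "B \<in> commutant (V ` carrier G)"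
  shows "(\<lambda>x. A (B x)) \<in> commutant (V ` carrier G)"
  using bounded_clin_compose[OF commutant_repD(1)[OF assms(1)] commutant_repD(1)[OF assms(2)]]
  by (rule commutant_repI) (simp add: commutant_repD(2)[OF assms(1)] commutant_repD(2)[OF assms(2)])

lemma csubspace_image:
  assumes D: "csubspace D"
    and add: "\<And>x y. x \<in> D \<Longrightarrow> y \<in> D \<Longrightarrow> f (x + y) = f x + f y"
    and scale: "\<And>c x. x \<in> D \<Longrightarrow> f (cscale c x) = cscale c (f x)"
  shows "csubspace (f ` D)"
  unfolding csubspace_def
proof (intro conjI ballI allI)
  have "f 0 = 0"
    using scale[OF csubspaceD(1)[OF D], of 0] by simp
  then show "0 \<in> f ` D"
    using csubspaceD(1)[OF D] by (metis image_eqI)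
  fix u v c assume "u \<in> f ` D"
  then obtain x where x: "x \<in> D" "u = f x" by blast
  then show "cscale c u \<in> f ` D"
    using csubspaceD(3)[OF D x(1), of c] by (simp flip: scale)
  assume "v \<in> f ` D"
  then obtain y where y: "y \<in> D" "v = f y" by blast
  then show "u + v \<in> f ` D"
    using csubspaceD(2)[OF D x(1) y(1)] by (simp add: x y flip: add)
qed

text \<open>An isometric image of a complete set is complete. Irreducibility speaks of closed
  subspaces, so the range of an isometric intertwiner must be known to be closed.\<close>

lemma closed_isometric_image:
  fixes U :: "'a::chilbert_space \<Rightarrow> 'a"
  assumes U: "bounded_clin U" and M: "closed_csubspace M"
    and iso: "\<And>x. x \<in> M \<Longrightarrow> norm (U x) = norm x"
  shows "closed_csubspace (U ` M)"
proof -
  have sub: "csubspace M" and cl: "closed M"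
    using M by (auto simp: closed_csubspace_def)
  have "subspace M"
    unfolding subspace_def using sub by (simp add: csubspaceD scaleR_cscale)
  moreover have "complete M" using cl by (simp add: complete_eq_closed)
  ultimately have "complete (U ` M)"
    using bounded_clin_imp_bounded_linear[OF U] iso
    by (intro complete_isometric_image[of 1]) auto
  moreover have "csubspace (U ` M)"
    by (rule csubspace_image[OF sub bounded_clinD(1,2)[OF U]])
  ultimately show ?thesis
    by (simp add: closed_csubspace_def complete_imp_closed)
qed

text \<open>Schur's lemma makes \<open>W\<^sup>* W\<close> a scalar on \<open>M1\<close>, so a nonzero \<open>W\<close> would be a multiple of a
  unitary equivalence.\<close>

lemma intertwiner_zero:
  fixes V :: "'g \<Rightarrow> 'h::chilbert_space \<Rightarrow> 'h"
  assumes rep: "unitary_rep G V" and irr1: "irreducible_subrep G V M1"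
    and irr2: "irreducible_subrep G V M2" and neq: "\<not> equivalent_subreps G V M1 M2"
    and A: "A \<in> commutant (V ` carrier G)" and x: "x \<in> M1"
  shows "orth_proj M2 (A x) = 0"
proof -
  have inv1: "invariant_subspace G V M1" and inv2: "invariant_subspace G V M2"
    using irr1 irr2 by (auto simp: irreducible_subrep_def)
  then have M1: "closed_csubspace M1" and M2: "closed_csubspace M2" and sub1: "csubspace M1"
    by (auto simp: invariant_subspace_def closed_csubspace_def)
  note P1 = orth_proj_in_commutant[OF rep inv1] and P2 = orth_proj_in_commutant[OF rep inv2]
  obtain B where B: "bounded_clin B" and adj: "\<And>x y. cinner (A x) y = cinner x (B y)"
    using adjoint_exists[OF commutant_repD(1)[OF A]] by blast
  note BV = adjoint_in_commutant[OF rep A B adj]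
  define W where "W = (\<lambda>x. orth_proj M2 (A x))"
  define W' where "W' = (\<lambda>y. orth_proj M1 (B (orth_proj M2 y)))"
  have W: "W \<in> commutant (V ` carrier G)"
    unfolding W_def by (rule commutant_rep_compose[OF P2 A])
  note bW = commutant_repD(1)[OF W]
  have WW': "cinner (W x) y = cinner x (W' y)" if "x \<in> M1" for x y
  proof -
    have "cinner (W x) y = cinner (orth_proj M1 x) (B (orth_proj M2 y))"
      by (simp add: W_def orth_proj_selfadjoint[OF M2] adj orth_proj_id[OF M1 that])
    then show ?thesis by (simp add: W'_def orth_proj_selfadjoint[OF M1])
  qed
  \<comment> \<open>\<open>W'\<close> is the adjoint of \<open>W\<close> as a map from
    \<open>M1\<close>. Composing with the projection onto \<open>M1\<close> makes the product
    symmetric on the whole space, the setting of Schur's lemma.\<close>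
  define E where "E = (\<lambda>x. W' (W (orth_proj M1 x)))"
  have E: "E \<in> commutant (V ` carrier G)"
    unfolding E_def W'_def
    by (rule commutant_rep_compose[OF P1 commutant_rep_compose[OF BV
          commutant_rep_compose[OF P2 commutant_rep_compose[OF W P1]]]])
  have sE: "symmetric_op E"
    unfolding symmetric_op_def
  proof (intro allI)
    fix x y
    have *: "cinner (orth_proj M1 x) (E y) = cinner x (E y)" for x y
      by (simp add: orth_proj_selfadjoint[OF M1] E_def W'_def orth_proj_id[OF M1 orth_proj_in[OF M1]])
    have "cinner x (E y) = cinner (W (orth_proj M1 x)) (W (orth_proj M1 y))" for x y
      using WW'[OF orth_proj_in[OF M1], of x] *[of x y] by (simp add: E_def)
    then show "cinner (E x) y = cinner x (E y)"
      by (metis cinner_commute)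
  qed
  have "E ` M1 \<subseteq> M1"
    by (auto simp: E_def W'_def orth_proj_in[OF M1])
  from schur_symmetric[OF rep irr1 E sE this]
  obtain a :: real where a: "\<And>x. x \<in> M1 \<Longrightarrow> E x = cscale a x" by blast
  have WW: "cinner (W x) (W y) = a * cinner x y" if "x \<in> M1" "y \<in> M1" for x y
    using WW'[OF that(1), of "W y"] a[OF that(2)]
    by (simp add: E_def orth_proj_id[OF M1 that(2)] cinner_cscale_right)
  have nW: "(norm (W x))\<^sup>2 = a * (norm x)\<^sup>2" if "x \<in> M1" for x
    using WW[OF that that] by (simp add: cinner_self flip: of_real_mult of_real_power)
  show ?thesis
  proof (cases "a = 0")
    case True
    then show ?thesis using nW[OF x] by (simp add: W_def)
  next
    case a0: False
    obtain e where e: "e \<in> M1" "e \<noteq> 0"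
      using irr1 csubspaceD(1)[OF sub1] by (auto simp: irreducible_subrep_def)
    have "0 \<le> a * (norm e)\<^sup>2"
      unfolding nW[OF e(1), symmetric] by simp
    then have apos: "a > 0"
      using e(2) a0 by (simp add: zero_le_mult_iff)
    \<comment> \<open>The scaling that makes \<open>W\<close> isometric on \<open>M1\<close>;
      positivity of \<open>a\<close> comes from \<open>nW\<close> at a nonzero vector.\<close>
    define s where "s = 1 / sqrt a"
    have s: "s * s * a = 1"
      using apos by (simp add: s_def)
    define U where "U = (\<lambda>x. cscale s (W x))"
    have bU: "bounded_clin U"
      unfolding U_def by (rule bounded_clin_cscale[OF bW])
    have UV: "U (V g x) = V g (U x)" if "g \<in> carrier G" for g x
      by (simp add: U_def commutant_repD(2)[OF W that]
          bounded_clinD[OF unitary_bounded_clin[OF rep that]])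
    have Uip: "cinner (U x) (U y) = cinner x y" if "x \<in> M1" "y \<in> M1" for x y
    proof -
      have "cinner (U x) (U y) = complex_of_real (s * s * a) * cinner x y"
        by (simp add: U_def cinner_cscale_left cinner_cscale_right WW[OF that])
      then show ?thesis by (simp add: s)
    qed
    have iso: "norm (U x) = norm x" if "x \<in> M1" for x
      using Uip[OF that that] by (simp add: norm_eq_sqrt_cinner)
    have "invariant_subspace G V (U ` M1)"
      unfolding invariant_subspace_def
    proof (intro conjI ballI)
      show "closed_csubspace (U ` M1)"
        by (rule closed_isometric_image[OF bU M1 iso])
      show "V g ` U ` M1 \<subseteq> U ` M1" if g: "g \<in> carrier G" for g
        using inv1 g unfolding invariant_subspace_def image_subset_iff
        by (auto simp: UV[OF g, symmetric])
    qed
    moreover have "U ` M1 \<subseteq> M2"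
      using M2 orth_proj_in[OF M2]
      by (auto simp: U_def W_def closed_csubspace_def intro: csubspaceD)
    moreover have "U ` M1 \<noteq> {0}"
    proof
      assume "U ` M1 = {0}"
      then have "U e = 0" using e(1) by blast
      then show False using iso[OF e(1)] e(2) by simp
    qed
    ultimately have "U ` M1 = M2"
      using irr2 unfolding irreducible_subrep_def by metis
    then have "equivalent_subreps G V M1 M2"
      unfolding equivalent_subreps_def using Uip UV bounded_clinD(1,2)[OF bU] by blast
    then show ?thesis using neq by blast
  qed
qed

section \<open>Multiplicity-free decompositions\<close>

text \<open>The vectors orthogonal to \<open>u\<close> form a closed subspace containing every
  component, hence the whole space. Identities between vectors can thus be tested one component at a
  time.\<close>

lemma orth_decomposition_total:
  fixes u :: "'h::chilbert_space"
  assumes dec: "orth_decomposition I Hs"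
    and orth: "\<And>n z. n \<in> I \<Longrightarrow> z \<in> Hs n \<Longrightarrow> cinner u z = 0"
  shows "u = 0"
proof -
  have "closed {z. cinner u z = 0}"
    by (intro closed_Collect_eq linear_continuous_on bounded_linear_cinner_right continuous_on_const)
  moreover have "cspan (\<Union>n\<in>I. Hs n) \<subseteq> {z. cinner u z = 0}"
    unfolding cspan_def
    using orth by (intro Inter_lower) (auto simp: csubspace_def cinner_add_right cinner_cscale_right)
  ultimately have "closure (cspan (\<Union>n\<in>I. Hs n)) \<subseteq> {z. cinner u z = 0}"
    by (rule closure_minimal[rotated])
  then have "cinner u u = 0"
    using dec by (auto simp: orth_decomposition_def)
  then show ?thesis by (simp add: cinner_self_eq_zero)
qed

lemma orth_decomposition_sum:
  fixes x :: "'h::chilbert_space"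
  assumes dec: "orth_decomposition I Hs" and fin: "finite I"
  shows "x = (\<Sum>k\<in>I. orth_proj (Hs k) x)"
proof -
  have Hs: "closed_csubspace (Hs k)" if "k \<in> I" for k
    using dec that by (simp add: orth_decomposition_def)
  have "x - (\<Sum>k\<in>I. orth_proj (Hs k) x) = 0"
  proof (rule orth_decomposition_total[OF dec])
    fix n z assume n: "n \<in> I" and z: "z \<in> Hs n"
    have "cinner (\<Sum>k\<in>I. orth_proj (Hs k) x) z = (\<Sum>k\<in>I. cinner (orth_proj (Hs k) x) z)"
      by (rule linear_sum[OF bounded_linear.linear[OF bounded_linear_cinner_left]])
    also have "\<dots> = (\<Sum>k\<in>I. if k = n then cinner (orth_proj (Hs n) x) z else 0)"
    proof (rule sum.cong)
      fix k assume "k \<in> I"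
      then show "cinner (orth_proj (Hs k) x) z = (if k = n then cinner (orth_proj (Hs n) x) z else 0)"
        using dec n z orth_proj_in[OF Hs, of k x] by (auto simp: orth_decomposition_def)
    qed simp
    also have "\<dots> = cinner (orth_proj (Hs n) x) z"
      using fin n by simp
    finally show "cinner (x - (\<Sum>k\<in>I. orth_proj (Hs k) x)) z = 0"
      using orth_proj_orth[OF Hs[OF n] z, of x] by (simp add: cinner_diff_left)
  qed
  then show ?thesis by simp
qed

locale multiplicity_free_rep =
  fixes G :: "('g, 'b) monoid_scheme" and V :: "'g \<Rightarrow> 'h::chilbert_space \<Rightarrow> 'h"
    and I :: "nat set" and Hs :: "nat \<Rightarrow> 'h set"
  assumes rep: "unitary_rep G V"
    and decomp: "orth_decomposition I Hs"
    and irred: "n \<in> I \<Longrightarrow> irreducible_subrep G V (Hs n)"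
    and ineq: "n \<in> I \<Longrightarrow> m \<in> I \<Longrightarrow> n \<noteq> m \<Longrightarrow> \<not> equivalent_subreps G V (Hs n) (Hs m)"
begin

lemma component_closed: "k \<in> I \<Longrightarrow> closed_csubspace (Hs k)"
  using decomp by (simp add: orth_decomposition_def)

lemma component_csubspace: "k \<in> I \<Longrightarrow> csubspace (Hs k)"
  using component_closed by (simp add: closed_csubspace_def)

lemma projection_in_commutant: "k \<in> I \<Longrightarrow> orth_proj (Hs k) \<in> commutant (V ` carrier G)"
  using orth_proj_in_commutant[OF rep] irred by (simp add: irreducible_subrep_def)

text \<open>The part of \<open>A x\<close> in another component is given by an intertwiner between
  inequivalent irreducible subrepresentations, so it vanishes.\<close>

lemma commutant_preserves_component:
  assumes A: "A \<in> commutant (V ` carrier G)" and k: "k \<in> I" and x: "x \<in> Hs k"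
  shows "A x \<in> Hs k"
proof -
  let ?P = "orth_proj (Hs k)"
  have "A x - ?P (A x) = 0"
  proof (rule orth_decomposition_total[OF decomp])
    fix n z assume n: "n \<in> I" and z: "z \<in> Hs n"
    show "cinner (A x - ?P (A x)) z = 0"
    proof (cases "n = k")
      case True
      then show ?thesis using orth_proj_orth[OF component_closed[OF k]] z by simp
    next
      case False
      then have "orth_proj (Hs n) (A x) = 0"
        using intertwiner_zero[OF rep irred[OF k] irred[OF n] ineq[OF k n] A x] by blast
      then have "cinner (A x) z = 0"
        using orth_proj_eq_zero_iff[OF component_closed[OF n]] z by blast
      moreover have "cinner (?P (A x)) z = 0"
        using decomp n k False z orth_proj_in[OF component_closed[OF k]]
        by (auto simp: orth_decomposition_def)
      ultimately show ?thesis by (simp add: cinner_diff_left)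
    qed
  qed
  then show ?thesis
    using orth_proj_in[OF component_closed[OF k], of "A x"] by simp
qed

text \<open>With \<open>P\<close> the projection, invariance under \<open>A\<close> gives
  \<open>A P = P A P\<close>. Invariance under the adjoint of \<open>A\<close> gives, after taking
  adjoints, \<open>P A = P A P\<close>.\<close>

lemma projection_commutes:
  assumes A: "A \<in> commutant (V ` carrier G)" and k: "k \<in> I"
  shows "orth_proj (Hs k) (A x) = A (orth_proj (Hs k) x)"
proof (rule cinner_ext)
  fix z
  let ?P = "orth_proj (Hs k)"
  note cl = component_closed[OF k]
  note id = orth_proj_id[OF cl] and inP = orth_proj_in[OF cl] and saP = orth_proj_selfadjoint[OF cl]
  obtain B where B: "bounded_clin B" and adj: "\<And>x y. cinner (A x) y = cinner x (B y)"
    using adjoint_exists[OF commutant_repD(1)[OF A]] by blast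
  note BV = adjoint_in_commutant[OF rep A B adj]
  have "cinner (?P (A x)) z = cinner x (B (?P z))"
    by (simp add: saP adj)
  also have "\<dots> = cinner x (?P (B (?P z)))"
    by (simp add: id[OF commutant_preserves_component[OF BV k inP]])
  also have "\<dots> = cinner (?P (A (?P x))) z"
    by (simp add: saP adj)
  also have "\<dots> = cinner (A (?P x)) z"
    by (simp add: id[OF commutant_preserves_component[OF A k inP]])
  finally show "cinner (?P (A x)) z = cinner (A (?P x)) z" .
qed

lemma projection_central:
  assumes k: "k \<in> I"
  defines "\<V> \<equiv> commutant (commutant (V ` carrier G))"
  shows "orth_proj (Hs k) \<in> \<V> \<inter> commutant \<V>"
proof -
  have b: "bounded_clin (orth_proj (Hs k))"
    by (rule bounded_clin_orth_proj[OF component_closed[OF k]])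
  have "orth_proj (Hs k) \<in> \<V>"
    using b projection_commutes[OF _ k]
    unfolding \<V>_def commutant_def[of "commutant (V ` carrier G)"] by (auto simp: fun_eq_iff)
  moreover have "orth_proj (Hs k) \<in> commutant \<V>"
    unfolding commutant_def[of \<V>]
  proof (intro CollectI conjI ballI)
    fix B assume "B \<in> \<V>"
    then have "\<forall>A\<in>commutant (V ` carrier G). B \<circ> A = A \<circ> B"
      unfolding \<V>_def commutant_def[of "commutant (V ` carrier G)"] by blast
    then show "orth_proj (Hs k) \<circ> B = B \<circ> orth_proj (Hs k)"
      using projection_in_commutant[OF k] by metis
  qed (rule b)
  ultimately show ?thesis by blast
qed

end

section \<open>The resolvent of a self-adjoint operator\<close>

lemma dense_orthogonal_zero:
  fixes u :: "'a::complex_inner"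
  assumes "closure D = UNIV" "\<And>w. w \<in> D \<Longrightarrow> cinner w u = 0"
  shows "u = 0"
proof -
  have "closed {z. cinner z u = 0}"
    by (intro closed_Collect_eq linear_continuous_on bounded_linear_cinner_left continuous_on_const)
  then have "closure D \<subseteq> {z. cinner z u = 0}"
    using assms(2) by (intro closure_minimal) auto
  then have "cinner u u = 0" using assms(1) by auto
  then show ?thesis by (simp add: cinner_self_eq_zero)
qed

locale self_adjoint_operator =
  fixes D :: "'h::chilbert_space set" and T :: "'h \<Rightarrow> 'h"
  assumes self_adjoint: "self_adjoint D T"
begin

lemma dom_csubspace: "csubspace D"
  and add: "x \<in> D \<Longrightarrow> y \<in> D \<Longrightarrow> T (x + y) = T x + T y"
  and scale: "x \<in> D \<Longrightarrow> T (cscale c x) = cscale c (T x)"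
  and dense: "closure D = UNIV"
  and symmetric: "x \<in> D \<Longrightarrow> y \<in> D \<Longrightarrow> cinner (T x) y = cinner x (T y)"
  using self_adjoint by (auto simp: self_adjoint_def densely_defined_def linear_op_on_def)

lemmas dom = csubspaceD[OF dom_csubspace]

lemma zero: "T 0 = 0"
  using scale[OF dom(1), of 0] by simp

lemma diff: "x \<in> D \<Longrightarrow> y \<in> D \<Longrightarrow> T (x - y) = T x - T y"
  using add[of x "cscale (- 1) y"] scale[of y "- 1"] dom(3)[of y "- 1"]
  by (simp add: cscale_minus_one)

text \<open>Self-adjointness used as maximality: satisfying the adjoint relation weakly already puts
  a vector into \<open>D\<close>. Mere symmetry of \<open>T\<close> would not give this.\<close>

lemma adjoint_domI:
  assumes "\<And>w. w \<in> D \<Longrightarrow> cinner (T w) x = cinner w z"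
  shows "x \<in> D" "T x = z"
proof -
  have "x \<in> adjoint_dom D T"
    using assms by (auto simp: adjoint_dom_def)
  then show x: "x \<in> D"
    using self_adjoint by (simp add: self_adjoint_def)
  have "T x - z = 0"
    by (rule dense_orthogonal_zero[OF dense])
       (simp add: cinner_diff_right assms symmetric[OF _ x, symmetric])
  then show "T x = z" by simp
qed

text \<open>The two conditions say that \<open>c\<close> is \<i> or its negative. Both values are
  treated together because the adjoint of the resolvent at one is the resolvent at the
  other.\<close>

context
  fixes c :: complex
  assumes c: "cnj c = - c" "cmod c = 1"
begin

definition shift :: "'h \<Rightarrow> 'h" where
  "shift x = T x + cscale c x"

definition resolvent :: "'h \<Rightarrow> 'h" where
  "resolvent y = (THE x. x \<in> D \<and> shift x = y)"

lemma shift_add: "x \<in> D \<Longrightarrow> y \<in> D \<Longrightarrow> shift (x + y) = shift x + shift y"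
  by (simp add: shift_def add cscale_add_right)

lemma shift_diff: "x \<in> D \<Longrightarrow> y \<in> D \<Longrightarrow> shift (x - y) = shift x - shift y"
  by (simp add: shift_def diff cscale_diff_right)

lemma shift_scale: "x \<in> D \<Longrightarrow> shift (cscale a x) = cscale a (shift x)"
  by (simp add: shift_def scale cscale_add_right cscale_cscale mult.commute)

text \<open>The cross term has zero real part: \<open>cinner (T x) x\<close> is real by symmetry and
  \<open>c\<close> is purely imaginary.\<close>

lemma norm_shift_sq: "x \<in> D \<Longrightarrow> (norm (shift x))\<^sup>2 = (norm (T x))\<^sup>2 + (norm x)\<^sup>2"
proof -
  assume x: "x \<in> D"
  have "cnj (cinner (T x) x) = cinner (T x) x"
    using symmetric[OF x x] cinner_commute[of x "T x"] by simp
  then have "Im (cinner (T x) x) = 0"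
    by (metis Reals_cnj_iff complex_is_Real_iff)
  moreover have "Re c = 0"
    using c(1) by (simp add: complex_eq_iff)
  ultimately have "Re (cinner (T x) (cscale c x)) = 0"
    by (simp add: cinner_cscale_right)
  then show ?thesis
    by (simp add: shift_def norm_add_sq norm_cscale c)
qed

lemma norm_le_shift: "x \<in> D \<Longrightarrow> norm x \<le> norm (shift x)"
  by (rule power2_le_imp_le) (simp_all add: norm_shift_sq)

lemma shift_inj: "x \<in> D \<Longrightarrow> y \<in> D \<Longrightarrow> shift x = shift y \<Longrightarrow> x = y"
  using norm_le_shift[of "x - y"] by (simp add: shift_diff dom)

text \<open>The lower bound on \<open>shift\<close> turns convergent images into Cauchy preimages.
  Their limit lies in \<open>D\<close> because the symmetry relation passes to the limit, that is,
  \<open>T\<close> is a closed operator.\<close>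

lemma closed_csubspace_range: "closed_csubspace (shift ` D)"
  unfolding closed_csubspace_def
proof
  show "csubspace (shift ` D)"
    by (rule csubspace_image[OF dom_csubspace shift_add shift_scale])
  show "closed (shift ` D)"
    unfolding closed_sequential_limits
  proof (intro allI impI, elim conjE)
    fix y l assume "\<forall>n. y n \<in> shift ` D" and lim: "y \<longlonglongrightarrow> l"
    then have "\<forall>n. \<exists>x. x \<in> D \<and> y n = shift x" by blast
    then obtain x where x: "\<And>n. x n \<in> D" and y: "\<And>n. y n = shift (x n)"
      by metis
    have le: "dist (x m) (x n) \<le> dist (y m) (y n)" for m n
      using norm_le_shift[of "x m - x n"] x by (simp add: dist_norm y shift_diff dom)
    have "Cauchy x"
      unfolding Cauchy_def
      using LIMSEQ_imp_Cauchy[OF lim, unfolded Cauchy_def] le by (meson le_less_trans)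
    then obtain p where p: "x \<longlonglongrightarrow> p"
      by (auto simp: Cauchy_convergent_iff convergent_def)
    have T: "(\<lambda>n. T (x n)) \<longlonglongrightarrow> l - cscale c p"
      using tendsto_diff[OF lim tendsto_cscale[OF p, of c]] by (simp add: y shift_def)
    have "cinner (T w) p = cinner w (l - cscale c p)" if w: "w \<in> D" for w
      using tendsto_cinner_right[OF p, of "T w"] tendsto_cinner_right[OF T, of w]
      by (simp add: symmetric[OF w x] LIMSEQ_unique)
    from adjoint_domI[OF this] have "p \<in> D" "shift p = l"
      by (simp_all add: shift_def)
    then show "l \<in> shift ` D" by blast
  qed
qed

text \<open>A vector orthogonal to the closed range is an eigenvector of \<open>T\<close> with the
  imaginary eigenvalue \<open>c\<close>, which symmetry allows only for zero.\<close>

lemma shift_surj: "y \<in> shift ` D"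
proof -
  note R = closed_csubspace_range
  define u where "u = y - orth_proj (shift ` D) y"
  have "cinner (T w) u = cinner w (cscale c u)" if w: "w \<in> D" for w
  proof -
    have "cinner u (shift w) = 0"
      unfolding u_def using w by (intro orth_proj_orth[OF R]) simp
    then have "cinner (shift w) u = 0"
      by (metis cinner_commute complex_cnj_zero)
    then show ?thesis
      by (simp add: shift_def cinner_add_left cinner_cscale_left cinner_cscale_right c)
  qed
  from adjoint_domI[OF this] have u: "u \<in> D" "T u = cscale c u" by auto
  then have "c * cinner u u = 0"
    using symmetric[OF u(1) u(1)] by (simp add: cinner_cscale_left cinner_cscale_right c)
  then have "u = 0"
    using c(2) by (auto simp: cinner_self_eq_zero)
  then show ?thesis
    using orth_proj_in[OF R, of y] by (simp add: u_def)
qed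

lemma resolvent_dom: "resolvent y \<in> D"
  and shift_resolvent: "shift (resolvent y) = y"
proof -
  have "\<exists>!x. x \<in> D \<and> shift x = y"
    using shift_surj[of y] shift_inj by blast
  from theI'[OF this] show "resolvent y \<in> D" "shift (resolvent y) = y"
    by (auto simp: resolvent_def)
qed

lemma resolvent_unique: "x \<in> D \<Longrightarrow> shift x = y \<Longrightarrow> resolvent y = x"
  using shift_inj[OF resolvent_dom] shift_resolvent by blast

lemma bounded_clin_resolvent: "bounded_clin resolvent"
proof (rule bounded_clinI[where K = 1])
  show "resolvent (x + y) = resolvent x + resolvent y" for x y
    by (rule resolvent_unique) (simp_all add: dom resolvent_dom shift_add shift_resolvent)
  show "resolvent (cscale a x) = cscale a (resolvent x)" for a x
    by (rule resolvent_unique) (simp_all add: dom resolvent_dom shift_scale shift_resolvent)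
  show "norm (resolvent x) \<le> 1 * norm x" for x
    using norm_le_shift[OF resolvent_dom, of x] by (simp add: shift_resolvent)
qed

lemma resolvent_in_commutant:
  assumes rep: "unitary_rep G V" and inv: "G_invariant_op G V D T"
  shows "resolvent \<in> commutant (V ` carrier G)"
proof (rule commutant_repI[OF bounded_clin_resolvent], rule resolvent_unique)
  fix g y assume g: "g \<in> carrier G"
  have VD: "V g x \<in> D" "T (V g x) = V g (T x)" if "x \<in> D" for x
    using inv g that by (auto simp: G_invariant_op_def)
  note V = bounded_clinD[OF unitary_bounded_clin[OF rep g]]
  show "V g (resolvent y) \<in> D" by (rule VD[OF resolvent_dom])
  have "shift (V g (resolvent y)) = V g (shift (resolvent y))"
    by (simp add: shift_def V VD resolvent_dom)
  then show "shift (V g (resolvent y)) = V g y"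
    by (simp add: shift_resolvent)
qed

text \<open>Every \<open>x\<close> in \<open>D\<close> is the resolvent of \<open>shift x\<close>.
  Commutation then exhibits \<open>A x\<close> as a value of the resolvent, which yields both
  membership in \<open>D\<close> and the identity for \<open>T\<close>.\<close>

lemma op_commutantI:
  assumes A: "bounded_clin A" and comm: "\<And>x. A (resolvent x) = resolvent (A x)"
  shows "A \<in> op_commutant D T"
proof -
  have "A x \<in> D \<and> T (A x) = A (T x)" if x: "x \<in> D" for x
  proof -
    have "x = resolvent (shift x)"
      using resolvent_unique[OF x] by simp
    then have Ax: "A x = resolvent (A (shift x))"
      using comm by metis
    then have "shift (A x) = A (shift x)"
      by (simp add: shift_resolvent)
    moreover have "A x \<in> D"
      by (subst Ax) (rule resolvent_dom)
    ultimately show ?thesis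
      by (simp add: shift_def bounded_clinD[OF A])
  qed
  then show ?thesis
    using A by (auto simp: op_commutant_def)
qed

end

lemma resolvent_adjoint: "cinner (resolvent \<i> x) y = cinner x (resolvent (- \<i>) y)"
proof -
  let ?a = "resolvent \<i> x" and ?b = "resolvent (- \<i>) y"
  have a: "?a \<in> D" "T ?a + cscale \<i> ?a = x"
    using resolvent_dom[of \<i> x] shift_resolvent[of \<i> x] by (simp_all add: shift_def)
  have b: "?b \<in> D" "T ?b + cscale (- \<i>) ?b = y"
    using resolvent_dom[of "- \<i>" y] shift_resolvent[of "- \<i>" y] by (simp_all add: shift_def)
  have "cinner ?a (T ?b + cscale (- \<i>) ?b) = cinner (T ?a + cscale \<i> ?a) ?b"
    using symmetric[OF a(1) b(1)]
    by (simp add: cinner_add_left cinner_add_right cinner_cscale_left cinner_cscale_right)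
  then show ?thesis by (simp only: a(2) b(2))
qed

end

section \<open>Invariant self-adjoint operators\<close>

context multiplicity_free_rep
begin

lemma projection_in_op_commutant:
  assumes sa: "self_adjoint D T" and inv: "G_invariant_op G V D T" and k: "k \<in> I"
  shows "orth_proj (Hs k) \<in> op_commutant D T"
proof -
  interpret self_adjoint_operator D T by unfold_locales (rule sa)
  show ?thesis
    by (rule op_commutantI[of \<i>, OF _ _ bounded_clin_orth_proj[OF component_closed[OF k]]
          projection_commutes[OF resolvent_in_commutant[OF _ _ rep inv] k]]) simp_all
qed

text \<open>The resolvent is not symmetric, but its real and imaginary parts are, and Schur's lemma
  applies to each of them.\<close>

lemma invariant_operator_scalar:
  assumes sa: "self_adjoint D T" and inv: "G_invariant_op G V D T" and k: "k \<in> I"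
  shows "\<exists>t::real. \<forall>x\<in>Hs k. x \<in> D \<and> T x = cscale t x"
proof -
  interpret self_adjoint_operator D T by unfold_locales (rule sa)
  note sub = component_csubspace[OF k]
  define R S where "R = resolvent \<i>" and "S = resolvent (- \<i>)"
  have R: "R \<in> commutant (V ` carrier G)" and S: "S \<in> commutant (V ` carrier G)"
    unfolding R_def S_def using resolvent_in_commutant[OF _ _ rep inv] by simp_all
  have adj: "cinner (R x) y = cinner x (S y)" for x y
    unfolding R_def S_def by (rule resolvent_adjoint)
  note adj' = adjoint_swap[OF adj]
  note bR = commutant_repD(1)[OF R] and bS = commutant_repD(1)[OF S]
  have RM: "R x \<in> Hs k" and SM: "S x \<in> Hs k" if "x \<in> Hs k" for x
    using commutant_preserves_component[OF _ k that] R S by auto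
  \<comment> \<open>\<open>S\<close> is the adjoint of \<open>R\<close>, so \<open>A\<close> and
    \<open>B\<close> are symmetric and \<open>R\<close> is half of \<open>A\<close> minus \<i> times
    \<open>B\<close>.\<close>
  define A where "A = (\<lambda>x. R x + S x)"
  define B where "B = (\<lambda>x. cscale \<i> (R x - S x))"
  have A: "A \<in> commutant (V ` carrier G)" and B: "B \<in> commutant (V ` carrier G)"
    unfolding A_def B_def
    using bR bS commutant_repD(2)[OF R] commutant_repD(2)[OF S]
    by (auto intro!: commutant_repI intro: bounded_clin_add bounded_clin_cscale bounded_clin_diff
        simp: bounded_clinD[OF unitary_bounded_clin[OF rep]])
  have "symmetric_op A" "symmetric_op B"
    by (simp_all add: symmetric_op_def A_def B_def cinner_add_left cinner_add_right cinner_diff_left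
        cinner_diff_right cinner_cscale_left cinner_cscale_right adj adj' algebra_simps)
  moreover have "A ` Hs k \<subseteq> Hs k" "B ` Hs k \<subseteq> Hs k"
    using RM SM by (auto simp: A_def B_def intro!: csubspaceD[OF sub])
  ultimately obtain a b :: real
    where a: "\<And>x. x \<in> Hs k \<Longrightarrow> A x = cscale a x" and b: "\<And>x. x \<in> Hs k \<Longrightarrow> B x = cscale b x"
    using schur_symmetric[OF rep irred[OF k] A] schur_symmetric[OF rep irred[OF k] B] by blast
  define r where "r = (complex_of_real a - \<i> * complex_of_real b) / 2"
  have Rr: "R x = cscale r x" if x: "x \<in> Hs k" for x
  proof -
    have "cscale \<i> (B x) = S x - R x"
      by (simp add: B_def cscale_cscale cscale_minus_one)
    then have "A x - cscale \<i> (B x) = R x + R x"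
      by (simp add: A_def)
    also have "\<dots> = cscale 2 (R x)"
      by (metis cscale_add_left cscale_one one_add_one)
    finally have "cscale (1/2) (cscale 2 (R x)) = cscale (1/2) (cscale a x - cscale \<i> (cscale b x))"
      by (simp add: a[OF x] b[OF x])
    then have "cscale (1/2 * 2) (R x) = cscale (1/2 * (a - \<i> * b)) x"
      by (simp only: cscale_cscale cscale_diff_left[symmetric])
    then show ?thesis by (simp add: r_def cscale_one)
  qed
  obtain e where e: "e \<in> Hs k" "e \<noteq> 0"
    using irred[OF k] csubspaceD(1)[OF sub] by (auto simp: irreducible_subrep_def)
  have RT: "R y \<in> D" "T (R y) + cscale \<i> (R y) = y" for y
    unfolding R_def using resolvent_dom[of \<i> y] shift_resolvent[of \<i> y] by (simp_all add: shift_def)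
  \<comment> \<open>The resolvent is injective, so it cannot vanish on a nonzero component.\<close>
  have r0: "r \<noteq> 0"
  proof
    assume "r = 0"
    then have "R e = 0" using Rr[OF e(1)] by simp
    then show False using RT(2)[of e] e(2) by (simp add: zero)
  qed
  \<comment> \<open>\<open>R\<close> inverts \<open>T\<close> plus \<i>, so where \<open>R\<close>
    is the scalar \<open>r\<close>, the operator \<open>T\<close> is \<open>1 / r\<close> minus
    \<i>.\<close>
  define t where "t = 1 / r - \<i>"
  have T: "x \<in> D \<and> T x = cscale t x" if x: "x \<in> Hs k" for x
  proof -
    have "R (cscale (1 / r) x) = x"
      using r0 by (simp add: Rr csubspaceD[OF sub] x cscale_cscale cscale_one)
    then have "x \<in> D" "T x + cscale \<i> x = cscale (1 / r) x"
      using RT[of "cscale (1 / r) x"] by simp_all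
    then show ?thesis by (simp add: t_def cscale_diff_left algebra_simps)
  qed
  have "cnj t * cinner e e = t * cinner e e"
    using symmetric[of e e] T[OF e(1)] by (simp add: cinner_cscale_left cinner_cscale_right)
  then have "cnj t = t"
    using e(2) by (simp add: cinner_self_eq_zero)
  then have "t = complex_of_real (Re t)"
    by (metis Reals_cnj_iff of_real_Re)
  with T show ?thesis by metis
qed

lemma finite_invariant_operator_decomposition:
  assumes sa: "self_adjoint D T" and inv: "G_invariant_op G V D T" and fin: "finite I"
  shows "D = UNIV" "bounded_clin T"
    and "\<exists>t::nat \<Rightarrow> real. \<forall>x. T x = (\<Sum>k\<in>I. cscale (t k) (orth_proj (Hs k) x))"
proof -
  interpret self_adjoint_operator D T by unfold_locales (rule sa)
  obtain t :: "nat \<Rightarrow> real" where t: "\<And>k x. k \<in> I \<Longrightarrow> x \<in> Hs k \<Longrightarrow> x \<in> D \<and> T x = cscale (t k) x"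
    using invariant_operator_scalar[OF sa inv] by metis
  \<comment> \<open>The domain is closed under finite sums and \<open>T\<close> is additive on it,
    so knowing \<open>T\<close> on the components determines it on all their finite sums.\<close>
  have sum: "sum f J \<in> D \<and> T (sum f J) = (\<Sum>k\<in>J. cscale (t k) (f k))"
    if "finite J" "J \<subseteq> I" "\<And>k. k \<in> J \<Longrightarrow> f k \<in> Hs k" for J f
    using that by (induction J) (auto simp: dom zero add t)
  have inP: "orth_proj (Hs k) x \<in> Hs k" if "k \<in> I" for k x
    by (rule orth_proj_in[OF component_closed[OF that]])
  have *: "x \<in> D \<and> T x = (\<Sum>k\<in>I. cscale (t k) (orth_proj (Hs k) x))" for x
    using sum[OF fin order_refl, of "\<lambda>k. orth_proj (Hs k) x"] inP
      orth_decomposition_sum[OF decomp fin, of x] by simp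
  then show "D = UNIV" and "\<exists>t::nat \<Rightarrow> real. \<forall>x. T x = (\<Sum>k\<in>I. cscale (t k) (orth_proj (Hs k) x))"
    by blast+
  have "bounded_clin (\<lambda>x. \<Sum>k\<in>J. cscale (t k) (orth_proj (Hs k) x))"
    if "finite J" "J \<subseteq> I" for J
    using that
    by (induction J)
       (simp_all add: bounded_clin_zero bounded_clin_add bounded_clin_cscale
          bounded_clin_orth_proj component_closed)
  from this[OF fin order_refl] show "bounded_clin T"
    using * by presburger
qed

end

text \<open>Solving \<open>\<i> * (l - 1) / (l + 1) = t\<close> for \<open>l\<close> gives this
  quotient. Numerator and denominator have equal modulus for real \<open>t\<close>, and
  \<open>l + 1\<close> has the nonzero numerator \<open>2 * \<i>\<close>, which excludes -1.\<close>

lemma cayley_transform_unit: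
  fixes t :: real
  defines "l \<equiv> (\<i> + t) / (\<i> - t)"
  shows "cmod l = 1" "l \<noteq> - 1" "\<i> * (l - 1) / (l + 1) = t"
proof -
  have ne: "\<i> - t \<noteq> 0" by (simp add: complex_eq_iff)
  have "cmod (\<i> + t) = cmod (\<i> - t)"
    by (simp add: cmod_def)
  then show "cmod l = 1"
    using ne by (simp add: l_def norm_divide)
  have p: "l + 1 = 2 * \<i> / (\<i> - t)" and m: "l - 1 = 2 * t / (\<i> - t)"
    using ne by (simp_all add: l_def field_simps)
  show "l \<noteq> - 1"
    using p ne by (metis add.left_inverse divide_eq_0_iff complex_i_not_zero mult_eq_0_iff zero_neq_numeral)
  show "\<i> * (l - 1) / (l + 1) = t"
    using ne by (simp add: p m)
qed

theorem theorem5p7: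
  fixes G :: "('g, 'b) monoid_scheme"
    and V :: "'g \<Rightarrow> 'h::chilbert_space \<Rightarrow> 'h"
    and N :: enat
    and Hs :: "nat \<Rightarrow> 'h set"
    and D :: "'h set"
    and T :: "'h \<Rightarrow> 'h"
  defines "I \<equiv> {n::nat. 1 \<le> n \<and> enat n \<le> N}"
      and "\<V> \<equiv> commutant (commutant ((\<lambda>g. V g) ` carrier G))"
  assumes sep: "separable_space (euclidean :: 'h topology)"
    and rep: "unitary_rep G V"
    and decomp: "orth_decomposition I Hs"
    and irred: "\<forall>n\<in>I. irreducible_subrep G V (Hs n)"
    and ineq: "\<forall>n\<in>I. \<forall>m\<in>I. n \<noteq> m \<longrightarrow> \<not> equivalent_subreps G V (Hs n) (Hs m)"
    and sa: "self_adjoint D T"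
    and inv: "G_invariant_op G V D T"
  shows "(\<forall>k\<in>I. orth_proj (Hs k) \<in> \<V> \<inter> commutant \<V> \<and> orth_proj (Hs k) \<in> op_commutant D T)
    \<and> (N < \<infinity> \<longrightarrow>
         D = UNIV \<and> bounded_clin T
         \<and> (\<exists>lam::nat \<Rightarrow> complex. (\<forall>k\<in>I. cmod (lam k) = 1 \<and> lam k \<noteq> -1)
              \<and> (\<forall>x. T x = (\<Sum>k\<in>I. cscale (\<i> * (lam k - 1) / (lam k + 1)) (orth_proj (Hs k) x)))))"
proof -
  interpret multiplicity_free_rep G V I Hs
    using rep decomp irred ineq by unfold_locales auto
  show ?thesis
  proof (intro conjI ballI impI)
    fix k assume k: "k \<in> I"
    show "orth_proj (Hs k) \<in> \<V> \<inter> commutant \<V>"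
      unfolding \<V>_def by (rule projection_central[OF k])
    show "orth_proj (Hs k) \<in> op_commutant D T"
      by (rule projection_in_op_commutant[OF sa inv k])
  next
    assume "N < \<infinity>"
    then obtain m where "N = enat m" by auto
    then have fin: "finite I"
      by (auto simp: I_def intro: finite_subset[of _ "{..m}"])
    show "D = UNIV" "bounded_clin T"
      by (rule finite_invariant_operator_decomposition[OF sa inv fin])+
    obtain t :: "nat \<Rightarrow> real"
      where t: "\<And>x. T x = (\<Sum>k\<in>I. cscale (t k) (orth_proj (Hs k) x))"
      using finite_invariant_operator_decomposition(3)[OF sa inv fin] by blast
    show "\<exists>lam. (\<forall>k\<in>I. cmod (lam k) = 1 \<and> lam k \<noteq> -1)
        \<and> (\<forall>x. T x = (\<Sum>k\<in>I. cscale (\<i> * (lam k - 1) / (lam k + 1)) (orth_proj (Hs k) x)))"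
    proof (intro exI conjI ballI allI)
      \<comment> \<open>The Cayley transform of each real eigenvalue; its inverse formula turns the
        coefficients back into \<open>t k\<close>.\<close>
      let ?lam = "\<lambda>k. (\<i> + t k) / (\<i> - t k)"
      show "cmod (?lam k) = 1" "?lam k \<noteq> - 1" for k
        by (rule cayley_transform_unit)+
      show "T x = (\<Sum>k\<in>I. cscale (\<i> * (?lam k - 1) / (?lam k + 1)) (orth_proj (Hs k) x))" for x
        by (simp only: t cayley_transform_unit(3))
    qed
  qed
qed

end
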